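(* Let $H$ be a Hamiltonian on the spin lattice $\Lambda$ with non-degenerate energies and non-degenerate gaps. Let $\mathcal{Z}$ be an approximately local constant of motion of $H$ with localisation region $X\subset\Lambda$, decay function $g$ and spectral gap $\gamma>0$; that is, $\mathcal{Z}$ is a Hermitian operator with $[H,\mathcal{Z}]=0$, it has $M\ge 2$ distinct eigenvalues any two of which differ by at least $\gamma$, and $\|\mathcal{Z}-\Gamma_{X_l}(\mathcal{Z})\|\le g(l)$ for all $l\in\mathbb{N}$. Assume that all eigenspaces of $\mathcal{Z}$ (as an operator on the full Hilbert space) have dimension at least $\widetilde{d}_{\min}$. Then for every $l\in\mathbb{N}$ there exists an operator $A$ supported on $X_l\supset X$ with $\|A\|=1$ such that for every finite region $S\subset\Lambda$ $$\overline{\|A_t-\Gamma_S(A_t)\|}\;\ge\;1-13\,\frac{g(l)}{\gamma}-\frac{d^{|S|}}{2\,\widetilde{d}_{\min}^{\,1/2}} .$$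
   Context: Setting: $\Lambda$ is a finite cubic lattice (of fixed dimension) with a spin of Hilbert space dimension $d$ at each site; the total Hilbert space is $\bigotimes_{x\in\Lambda}\mathbb{C}^d$. A Hamiltonian is a Hermitian operator on this space. Regions are subsets of $\Lambda$; $|S|$ is the number of sites in $S$ and $S^c=\Lambda\setminus S$. An operator is supported on $S$ if it acts as the identity on $S^c$. $\|\cdot\|$ is the operator norm. For a region $X$, $X_l$ is the set of all sites within Manhattan distance $l$ of $X$ (including $X$). The restriction map is $\Gamma_S(A)=d^{-|S^c|}\,\mathbb{I}_{S^c}\otimes \mathrm{tr}_{S^c}(A)$, with $\mathrm{tr}_{S^c}$ the partial trace over $S^c$. Heisenberg evolution: $A_t=e^{itH}Ae^{-itH}$. The bar denotes the infinite time average, $\overline{F(t)}=\lim_{T\to\infty}\frac1T\int_0^T F(t)\,\mathrm{d}t$. Non-degenerate energies: all eigenvalues $E_k$ of $H$ are simple. Non-degenerate gaps: $E_i-E_j=E_k-E_m\neq 0$ implies $i=k$ and $j=m$. The decay function is a function $g:\mathbb{N}\to\mathbb{R}$ (thought of as rapidly decaying). In the paper, $\gamma$ and $M$ are understood to be independent of the system size. *)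

theory Defs
  imports "HOL-Analysis.Analysis"
begin

text \<open>
  Sites are the elements of a finite type \<open>'x\<close>, placed in $\mathbb{Z}^D$ by a map \<open>pos\<close> (with
  $D$ the cardinality of \<open>'n\<close>). The local Hilbert space is $\mathbb{C}^d$ with $d$ the cardinality
  of \<open>'d\<close>. The product basis of the total Hilbert space is indexed by the configurations
  \<open>'x \<Rightarrow> 'd\<close>, and operators are given by their matrices in this basis; the entry
  \<open>A $ \<sigma> $ \<tau>\<close> is $\langle\sigma|A|\tau\rangle$.
\<close>

type_synonym ('x, 'd) observable = "((complex, 'x \<Rightarrow> 'd) vec, 'x \<Rightarrow> 'd) vec"

subsection \<open>The lattice\<close>

definition cubic_lattice :: "('x::finite \<Rightarrow> int ^ 'n::finite) \<Rightarrow> bool" where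
  "cubic_lattice pos \<longleftrightarrow>
     (\<exists>len :: 'n \<Rightarrow> nat. bij_betw pos UNIV {p. \<forall>k. 0 \<le> p $ k \<and> p $ k < int (len k)})"

definition manhattan :: "int ^ 'n::finite \<Rightarrow> int ^ 'n \<Rightarrow> int" where
  "manhattan p q = (\<Sum>k\<in>UNIV. \<bar>p $ k - q $ k\<bar>)"

definition nbhd :: "('x::finite \<Rightarrow> int ^ 'n::finite) \<Rightarrow> 'x set \<Rightarrow> nat \<Rightarrow> 'x set" where
  "nbhd pos X l = {y. \<exists>x\<in>X. manhattan (pos x) (pos y) \<le> int l}"

subsection \<open>Complex matrices\<close>

definition scale_mat :: "complex \<Rightarrow> complex ^ 'b::finite ^ 'a::finite \<Rightarrow> complex ^ 'b ^ 'a" where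
  "scale_mat c A = (\<chi> i j. c * A $ i $ j)"

definition hermitian_mat :: "complex ^ 'a::finite ^ 'a \<Rightarrow> bool" where
  "hermitian_mat A \<longleftrightarrow> (\<forall>i j. A $ i $ j = cnj (A $ j $ i))"

definition opnorm :: "complex ^ 'a::finite ^ 'a \<Rightarrow> real" where
  "opnorm A = onorm (\<lambda>v. A *v v)"

primrec mat_power :: "complex ^ 'a::finite ^ 'a \<Rightarrow> nat \<Rightarrow> complex ^ 'a ^ 'a" where
  "mat_power A 0 = mat 1"
| "mat_power A (Suc n) = A ** mat_power A n"

text \<open>\<open>exp\<close> is not available on the type of matrices, which carries no algebra instance.\<close>

definition mat_exp :: "complex ^ 'a::finite ^ 'a \<Rightarrow> complex ^ 'a ^ 'a" where
  "mat_exp A = (\<Sum>n. (1 / fact n) *\<^sub>R mat_power A n)"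

definition eigenspace :: "complex ^ 'a::finite ^ 'a \<Rightarrow> complex \<Rightarrow> (complex ^ 'a) set" where
  "eigenspace A e = {v. A *v v = e *s v}"

definition eigenvalues :: "complex ^ 'a::finite ^ 'a \<Rightarrow> complex set" where
  "eigenvalues A = {e. \<exists>v. v \<noteq> 0 \<and> A *v v = e *s v}"

subsection \<open>Supports and the restriction map\<close>

text \<open>
  An operator on the Hilbert space of a region \<open>S\<close> is given by its matrix entries
  \<open>B \<alpha> \<beta>\<close> for configurations \<open>\<alpha>, \<beta> \<in> S \<rightarrow>\<^sub>E UNIV\<close> of \<open>S\<close>; other arguments are irrelevant.
  \<open>tensor_id S B\<close> is the operator $B \otimes \mathbb{I}_{S^c}$ on the whole lattice.
\<close>

definition tensor_id ::
    "'x set \<Rightarrow> (('x \<Rightarrow> 'd) \<Rightarrow> ('x \<Rightarrow> 'd) \<Rightarrow> complex) \<Rightarrow> ('x::finite, 'd::finite) observable" where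
  "tensor_id S B =
     (\<chi> \<sigma> \<tau>. if \<forall>x\<in>-S. \<sigma> x = \<tau> x then B (restrict \<sigma> S) (restrict \<tau> S) else 0)"

definition supported_on :: "('x::finite, 'd::finite) observable \<Rightarrow> 'x set \<Rightarrow> bool" where
  "supported_on A S \<longleftrightarrow> (\<exists>B. A = tensor_id S B)"

text \<open>
  \<open>partial_trace R A\<close> traces out the sites in \<open>R\<close>: the configurations \<open>\<alpha>, \<beta>\<close> of the remaining
  sites are completed on \<open>R\<close> by the same configuration \<open>\<eta>\<close>, which is summed over.
\<close>

definition partial_trace ::
    "'x set \<Rightarrow> ('x::finite, 'd::finite) observable \<Rightarrow> ('x \<Rightarrow> 'd) \<Rightarrow> ('x \<Rightarrow> 'd) \<Rightarrow> complex" where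
  "partial_trace R A \<alpha> \<beta> =
     (\<Sum>\<eta> \<in> R \<rightarrow>\<^sub>E UNIV. A $ override_on \<alpha> \<eta> R $ override_on \<beta> \<eta> R)"

definition restriction_map ::
    "'x set \<Rightarrow> ('x::finite, 'd::finite) observable \<Rightarrow> ('x, 'd) observable" where
  "restriction_map S A =
     scale_mat (1 / of_nat (CARD('d) ^ card (-S))) (tensor_id S (partial_trace (-S) A))"

subsection \<open>Dynamics\<close>

definition heisenberg ::
    "('x::finite, 'd::finite) observable \<Rightarrow> ('x, 'd) observable \<Rightarrow> real \<Rightarrow> ('x, 'd) observable" where
  "heisenberg H A t =
     mat_exp (scale_mat (\<i> * of_real t) H) ** A ** mat_exp (scale_mat (- \<i> * of_real t) H)"

definition has_time_average :: "(real \<Rightarrow> real) \<Rightarrow> real \<Rightarrow> bool" where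
  "has_time_average F m \<longleftrightarrow> ((\<lambda>T. (1 / T) * integral {0..T} F) \<longlongrightarrow> m) at_top"

definition nondegenerate_energies :: "('x::finite, 'd::finite) observable \<Rightarrow> bool" where
  "nondegenerate_energies H \<longleftrightarrow> (\<forall>e\<in>eigenvalues H. vec.dim (eigenspace H e) = 1)"

text \<open>
  The energies are indexed by themselves here, so this is the usual condition on the indices
  when it is combined with \<open>nondegenerate_energies\<close>.
\<close>

definition nondegenerate_gaps :: "('x::finite, 'd::finite) observable \<Rightarrow> bool" where
  "nondegenerate_gaps H \<longleftrightarrow>
     (\<forall>Ei\<in>eigenvalues H. \<forall>Ej\<in>eigenvalues H. \<forall>Ek\<in>eigenvalues H. \<forall>Em\<in>eigenvalues H.
        Ei - Ej = Ek - Em \<and> Ek - Em \<noteq> 0 \<longrightarrow> Ei = Ek \<and> Ej = Em)"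

definition approx_local_constant_of_motion ::
    "('x::finite \<Rightarrow> int ^ 'n::finite) \<Rightarrow> ('x, 'd::finite) observable \<Rightarrow> ('x, 'd) observable
      \<Rightarrow> 'x set \<Rightarrow> (nat \<Rightarrow> real) \<Rightarrow> real \<Rightarrow> bool" where
  "approx_local_constant_of_motion pos H Z X g \<gamma> \<longleftrightarrow>
     hermitian_mat Z \<and>
     H ** Z = Z ** H \<and>
     \<gamma> > 0 \<and>
     card (eigenvalues Z) \<ge> 2 \<and>
     (\<forall>e\<in>eigenvalues Z. \<forall>f\<in>eigenvalues Z. e \<noteq> f \<longrightarrow> cmod (e - f) \<ge> \<gamma>) \<and>
     (\<forall>l. opnorm (Z - restriction_map (nbhd pos X l) Z) \<le> g l)"

end

theory Submission
  imports Defs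
begin

text \<open>
  Non-degeneracy makes \<open>Z\<close> diagonal in an energy eigenbasis. The eigenvectors of the local operator
  $\Gamma_{X_l}(Z)$ whose eigenvalue is within $g(l)$ of an eigenvalue $z_i$ of \<open>Z\<close>
  almost lie in the range of the spectral projection $P_i$ of \<open>Z\<close>, and by a dimension count there are at least \<open>dmin\<close> of them. Let
  \<open>A\<close> exchange equally many product eigenvectors near $z_1$ and near $z_2$, at least \<open>dmin\<close> of
  each; it is local and of norm one. Its normalised off-diagonal part
  $K = (P_1 A P_2 + P_2 A P_1) / \mathrm{rank}\, A$ has trace norm at most one, nearly optimal
  overlap with \<open>A\<close>, zero diagonal in the energy basis and
  squared Hilbert-Schmidt norm at most $1 / (2 \widetilde{d}_{\min})$. Testing
  $A_t - \Gamma_S(A_t)$ against the evolved $K_t$ leaves the error term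
  $\langle \Gamma_S(K_t), A_t \rangle$. As the gaps are distinct, no cross terms survive
  in the time average of $\|\Gamma_S(K_t)\|^2$, which is therefore at most
  $\|K\|^2 / d^{|S^c|}$. The time average of the norm itself exists because, by Stone-Weierstrass, it is
  a uniform limit of trigonometric polynomials.
\<close>

subsection \<open>The Hermitian inner product\<close>

text \<open>Two demands conflict. \<open>A\<close> has to be local, while the operator it is tested
  against must have no diagonal in the energy basis, since diagonal parts never dephase. The
  projections of \<open>Z\<close> are not local, so \<open>A\<close> and \<open>K\<close> are
  different operators, and the perturbation estimate keeps their overlap near one. The loss is
  quadratic, at most 4 \<delta>^2 with \<delta> = g / (\<gamma> - g). If 13 g < \<gamma>, this is at
  most 13 g / \<gamma>; otherwise the claimed bound is not positive and the identity serves as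
  \<open>A\<close>. Cauchy-Schwarz suggests an error of the square root of d^|S| / (2 dmin): the
  factor d^|S| is the total dimension divided by d^|S^c|, and the 2 comes from exchanging in both
  directions, which doubles the rank. This is at most d^|S| / (2 dmin^(1/2)) once d^|S| \<ge> 2,
  hence for every nonempty S, because two distinct eigenvalues of \<open>Z\<close> force d \<ge> 2.
  For empty S the error vanishes, \<open>K\<close> being traceless.\<close>

definition cin :: "complex ^ 'a::finite \<Rightarrow> complex ^ 'a \<Rightarrow> complex" where
  "cin u v = (\<Sum>i\<in>UNIV. cnj (u $ i) * v $ i)"

lemma cin_add_right: "cin u (v + w) = cin u v + cin u w"
  by (simp add: cin_def algebra_simps sum.distrib)

lemma cin_add_left: "cin (u + w) v = cin u v + cin w v"
  by (simp add: cin_def algebra_simps sum.distrib)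

lemma cin_diff_right: "cin u (v - w) = cin u v - cin u w"
  by (simp add: cin_def algebra_simps sum_subtractf)

lemma cin_diff_left: "cin (u - w) v = cin u v - cin w v"
  by (simp add: cin_def algebra_simps sum_subtractf)

lemma cin_scale_right: "cin u (c *s v) = c * cin u v"
  by (simp add: cin_def sum_distrib_left mult_ac)

lemma cin_scale_left: "cin (c *s u) v = cnj c * cin u v"
  by (simp add: cin_def sum_distrib_left mult_ac)

lemma cin_zero [simp]: "cin u 0 = 0" "cin 0 u = 0"
  by (simp_all add: cin_def)

lemma cin_sum_right: "cin u (sum f L) = (\<Sum>l\<in>L. cin u (f l))"
  by (induction L rule: infinite_finite_induct) (simp_all add: cin_add_right)

lemma cin_sum_left: "cin (sum f L) u = (\<Sum>l\<in>L. cin (f l) u)"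
  by (induction L rule: infinite_finite_induct) (simp_all add: cin_add_left)

lemma cin_cnj: "cnj (cin u v) = cin v u"
  by (simp add: cin_def mult.commute)

lemma Re_cin: "Re (cin u v) = u \<bullet> v"
  by (simp add: cin_def inner_vec_def inner_complex_def)

lemma cin_self: "cin v v = of_real ((norm v)\<^sup>2)"
proof -
  have "Im (cin v v) = 0"
    using arg_cong[OF cin_cnj[of v v], of Im] by simp
  then show ?thesis
    by (simp add: complex_eq_iff Re_cin power2_norm_eq_inner)
qed

lemma cmod_cin_le: "cmod (cin u v) \<le> norm u * norm v"
proof (cases "cin u v = 0")
  case False
  \<comment> \<open>The phase \<open>c\<close> rotates the product onto the positive real axis,
    where it is a real inner product and the real Cauchy-Schwarz inequality applies.\<close>
  define c where "c = cnj (cin u v) / cmod (cin u v)"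
  have c: "cmod c = 1" using False by (simp add: c_def norm_divide)
  have "cin u (c *s v) = cmod (cin u v)"
    using False by (simp add: cin_scale_right c_def complex_norm_square[symmetric]
        power2_eq_square field_simps)
  then have "cmod (cin u v) = u \<bullet> (c *s v)"
    by (metis Re_cin Re_complex_of_real)
  also have "\<dots> \<le> norm u * norm (c *s v)"
    by (rule norm_cauchy_schwarz)
  also have "norm (c *s v) = norm v"
    by (simp add: norm_vec_def norm_mult c)
  finally show ?thesis .
qed auto

lemma mult_cnj_cmod: "z * cnj z = (complex_of_real (cmod z))\<^sup>2"
  using complex_norm_square[of z] by simp

lemma of_real_smult: "complex_of_real r *s v = r *\<^sub>R v"
  by (simp add: vec_eq_iff scaleR_conv_of_real[symmetric])

subsection \<open>Orthonormal families\<close>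

text \<open>Families are indexed, so that product bases can be indexed by pairs and the two sides of
  a partial isometry can share an index. Finiteness is built in because sums over infinite sets are
  0 by convention.\<close>

definition orthonormal :: "'l set \<Rightarrow> ('l \<Rightarrow> complex ^ 'a::finite) \<Rightarrow> bool" where
  "orthonormal L a \<longleftrightarrow> finite L \<and> (\<forall>l\<in>L. \<forall>m\<in>L. cin (a l) (a m) = (if l = m then 1 else 0))"

definition onb :: "'l set \<Rightarrow> ('l \<Rightarrow> complex ^ 'a::finite) \<Rightarrow> bool" where
  "onb L a \<longleftrightarrow> orthonormal L a \<and> (\<forall>v. (\<Sum>l\<in>L. cin (a l) v *s a l) = v)"

lemma orthonormalD:
  assumes "orthonormal L a" "l \<in> L" "m \<in> L"
  shows "cin (a l) (a m) = (if l = m then 1 else 0)"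
  using assms by (auto simp: orthonormal_def)

lemma orthonormal_finite: "orthonormal L a \<Longrightarrow> finite L"
  by (simp add: orthonormal_def)

lemma orthonormal_norm:
  assumes "orthonormal L a" "l \<in> L"
  shows "norm (a l) = 1"
  using orthonormalD[OF assms(1,2,2)] cin_self[of "a l"] 
  by (metis norm_ge_zero of_real_eq_1_iff power2_eq_1_iff zero_le_one abs_of_nonneg abs_1 power2_eq_iff_nonneg)

lemma cin_orthonormal_sum:
  assumes "orthonormal L a" "l \<in> L"
  shows "cin (a l) (\<Sum>m\<in>L. c m *s a m) = c l"
proof -
  have "cin (a l) (\<Sum>m\<in>L. c m *s a m) = (\<Sum>m\<in>L. if l = m then c m else 0)"
    unfolding cin_sum_right cin_scale_right
    by (intro sum.cong refl) (simp add: orthonormalD[OF assms(1,2)])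
  then show ?thesis
    using assms orthonormal_finite[OF assms(1)] by simp
qed

lemma norm_orthonormal_sum:
  assumes "orthonormal L a"
  shows "(norm (\<Sum>m\<in>L. c m *s a m))\<^sup>2 = (\<Sum>m\<in>L. (cmod (c m))\<^sup>2)"
proof -
  have "complex_of_real ((norm (\<Sum>m\<in>L. c m *s a m))\<^sup>2)
      = cin (\<Sum>m\<in>L. c m *s a m) (\<Sum>m\<in>L. c m *s a m)"
    by (simp only: cin_self)
  also have "\<dots> = (\<Sum>m\<in>L. cnj (c m) * c m)"
    unfolding cin_sum_left[of _ L] cin_scale_left
    by (intro sum.cong refl) (simp add: cin_orthonormal_sum[OF assms])
  also have "\<dots> = complex_of_real (\<Sum>m\<in>L. (cmod (c m))\<^sup>2)"
    by (simp add: complex_norm_square mult.commute del: of_real_power)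
  finally show ?thesis using of_real_eq_iff by blast
qed

text \<open>Pythagoras for \<open>v = p + (v - p)\<close>, with \<open>p\<close> the orthogonal
  projection of \<open>v\<close> onto the span of the family.\<close>

lemma bessel:
  assumes "orthonormal L a"
  shows "(\<Sum>l\<in>L. (cmod (cin (a l) v))\<^sup>2) \<le> (norm v)\<^sup>2"
proof -
  define p where "p = (\<Sum>l\<in>L. cin (a l) v *s a l)"
  have pv: "cin p (v - p) = 0"
  proof -
    have "cin (a l) (v - p) = 0" if "l \<in> L" for l
      using that by (simp add: p_def cin_diff_right cin_orthonormal_sum[OF assms])
    then show ?thesis
      by (subst p_def) (simp add: cin_sum_left[of _ L] cin_scale_left)
  qed
  have "norm (p + (v - p)) ^ 2 = (norm p)\<^sup>2 + (norm (v - p))\<^sup>2"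
    by (rule norm_add_Pythagorean) (use pv Re_cin[of p "v - p"] in \<open>simp add: orthogonal_def\<close>)
  then have "(norm v)\<^sup>2 = (norm p)\<^sup>2 + (norm (v - p))\<^sup>2" by simp
  then have "(norm p)\<^sup>2 \<le> (norm v)\<^sup>2" by simp
  then show ?thesis by (simp add: p_def norm_orthonormal_sum[OF assms])
qed

lemma onb_orthonormal: "onb L a \<Longrightarrow> orthonormal L a"
  by (simp add: onb_def)

lemma onb_expand: "onb L a \<Longrightarrow> (\<Sum>l\<in>L. cin (a l) v *s a l) = v"
  by (simp add: onb_def)

lemma onb_norm:
  assumes "onb L a"
  shows "(norm v)\<^sup>2 = (\<Sum>l\<in>L. (cmod (cin (a l) v))\<^sup>2)"
  using norm_orthonormal_sum[OF onb_orthonormal[OF assms]] onb_expand[OF assms] by metis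

lemma onb_eqI:
  assumes "onb L a" "\<And>l. l \<in> L \<Longrightarrow> cin (a l) u = cin (a l) v"
  shows "u = v"
proof -
  have "(\<Sum>l\<in>L. cin (a l) u *s a l) = (\<Sum>l\<in>L. cin (a l) v *s a l)"
    using assms(2) by (intro sum.cong) auto
  then show ?thesis by (simp add: onb_expand[OF assms(1)])
qed

subsection \<open>Spectral theorem\<close>

lemma hermitian_cin:
  assumes "hermitian_mat A"
  shows "cin (A *v u) v = cin u (A *v v)"
proof -
  have cnjA: "cnj (A $ i $ j) = A $ j $ i" for i j
    using assms by (metis hermitian_mat_def)
  have "cin (A *v u) v = (\<Sum>i\<in>UNIV. \<Sum>j\<in>UNIV. cnj (A $ i $ j) * cnj (u $ j) * v $ i)"
    by (simp add: cin_def matrix_vector_mult_def sum_distrib_right)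
  also have "\<dots> = (\<Sum>j\<in>UNIV. \<Sum>i\<in>UNIV. cnj (u $ j) * (A $ j $ i * v $ i))"
    by (subst sum.swap) (simp add: cnjA mult_ac)
  also have "\<dots> = cin u (A *v v)"
    by (simp add: cin_def matrix_vector_mult_def sum_distrib_left)
  finally show ?thesis .
qed

lemma matvec_smult: "A *v (c *s v) = c *s (A *v (v :: complex ^ 'a::finite))"
  by (simp add: vec_eq_iff matrix_vector_mult_def sum_distrib_left mult_ac)

lemma matvec_sum: "A *v (sum f L) = (\<Sum>l\<in>L. A *v (f l :: complex ^ 'a::finite))"
  by (induction L rule: infinite_finite_induct) (simp_all add: matrix_vector_right_distrib)

lemma bounded_linear_matvec: "bounded_linear (\<lambda>v. A *v (v :: complex ^ 'a::finite))"
  by (intro linear_conv_bounded_linear[THEN iffD1] linearI)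
    (simp_all add: matrix_vector_right_distrib matvec_smult flip: of_real_smult)

text \<open>Variational argument: the Rayleigh quotient attains its maximum \<open>e\<close> on the
  unit sphere of \<open>W\<close> at some \<open>v\<close>. The residual
  \<open>w = A *v v - e *\<^sub>R v\<close> lies in \<open>W\<close> and is orthogonal to
  \<open>v\<close>. Moving from \<open>v\<close> to \<open>v + t *\<^sub>R w\<close> changes the
  quotient to first order by a multiple of \<open>w \<bullet> w\<close>, so maximality forces
  \<open>w = 0\<close>.\<close>

lemma hermitian_eigenvector_in_subspace:
  fixes A :: "complex ^ 'a::finite ^ 'a"
  assumes A: "hermitian_mat A" and W: "vec.subspace W" and inv: "\<And>v. v \<in> W \<Longrightarrow> A *v v \<in> W"
    and nz: "w0 \<in> W" "w0 \<noteq> 0"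
  shows "\<exists>v e. v \<in> W \<and> norm v = 1 \<and> A *v v = e *s v"
proof -
  have subW: "subspace W"
    using W by (auto simp: subspace_def vec.subspace_def simp flip: of_real_smult)
  let ?S = "W \<inter> sphere 0 1"
  have "compact ?S"
    by (intro closed_Int_compact closed_subspace subW compact_sphere)
  moreover have "(1 / norm w0) *\<^sub>R w0 \<in> ?S"
    using nz by (simp add: subspace_scale[OF subW])
  moreover have "continuous_on ?S (\<lambda>v. v \<bullet> (A *v v))"
    by (intro continuous_intros linear_continuous_on bounded_linear_matvec)
  ultimately obtain v where v: "v \<in> ?S" and max: "\<And>u. u \<in> ?S \<Longrightarrow> u \<bullet> (A *v u) \<le> v \<bullet> (A *v v)"
    using continuous_attains_sup[of ?S] by blast
  define e where "e = v \<bullet> (A *v v)"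
  have sym: "x \<bullet> (A *v y) = (A *v x) \<bullet> y" for x y
    by (metis Re_cin hermitian_cin[OF A])
  have lin: "A *v (r *\<^sub>R x) = r *\<^sub>R (A *v x)" for r x
    by (simp add: matvec_smult flip: of_real_smult)
  have le: "u \<bullet> (A *v u) \<le> e * (u \<bullet> u)" if "u \<in> W" for u
  proof (cases "u = 0")
    case False
    have "(1 / norm u) *\<^sub>R u \<in> ?S"
      using that False by (simp add: subspace_scale[OF subW])
    from max[OF this] have "(u \<bullet> (A *v u)) / (norm u)\<^sup>2 \<le> e"
      by (simp add: lin e_def power2_eq_square)
    then show ?thesis using False by (simp add: field_simps power2_norm_eq_inner)
  qed simp
  define w where "w = A *v v - e *\<^sub>R v"
  have vv: "v \<bullet> v = 1" using v by (simp add: dot_square_norm)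
  have wW: "w \<in> W" unfolding w_def using v
    by (intro subspace_diff[OF subW] subspace_scale[OF subW] inv) auto
  have wv: "w \<bullet> v = 0"
    by (simp add: w_def inner_diff_left vv e_def inner_commute[of "A *v v"])
  have wAv: "w \<bullet> (A *v v) = w \<bullet> w"
    using wv by (simp add: w_def inner_diff_right)
  define k where "k = e * (w \<bullet> w) - w \<bullet> (A *v w)"
  have quad: "2 * t * (w \<bullet> w) \<le> t\<^sup>2 * k" for t
  proof -
    have "v + t *\<^sub>R w \<in> W" using v wW by (auto intro!: subspace_add[OF subW] subspace_scale[OF subW])
    from le[OF this] have "e + 2 * t * (w \<bullet> w) + t\<^sup>2 * (w \<bullet> (A *v w)) \<le> e * (1 + t\<^sup>2 * (w \<bullet> w))"
      using wAv wv vv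
      by (simp add: matrix_vector_right_distrib lin inner_add_left inner_add_right
          inner_commute[of v w] sym[of v w] inner_commute[of "A *v v" w] 
          power2_eq_square algebra_simps flip: e_def)
    then show ?thesis by (simp add: k_def algebra_simps)
  qed
  have "w \<bullet> w \<le> 0"
  proof (rule ccontr)
    assume "\<not> w \<bullet> w \<le> 0"
    then have pos: "w \<bullet> w > 0" by linarith
    \<comment> \<open>The value is small enough for the linear term to beat the quadratic one:
      \<open>t * \<bar>k\<bar>\<close> stays below \<open>w \<bullet> w\<close>.\<close>
    define t where "t = (w \<bullet> w) / (\<bar>k\<bar> + 1)"
    have t: "t > 0" using pos by (simp add: t_def)
    have "2 * (w \<bullet> w) \<le> t * k"
      using quad[of t] t by (simp add: power2_eq_square mult.assoc)
    also have "\<dots> \<le> t * (\<bar>k\<bar> + 1)" using t by (intro mult_left_mono) auto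
    also have "\<dots> = w \<bullet> w" by (simp add: t_def)
    finally show False using pos by simp
  qed
  then have "w = 0" using inner_gt_zero_iff[of w] by argo
  then have "A *v v = of_real e *s v" by (simp add: w_def of_real_smult)
  then show ?thesis using v by auto
qed

text \<open>Independence over the reals suffices. The real dimension is twice the complex one, but
  the bound only has to guarantee that a largest orthonormal set of eigenvectors exists.\<close>

lemma orthonormal_card_le:
  assumes "orthonormal B (\<lambda>b. b :: complex ^ 'a::finite)"
  shows "card B \<le> DIM(complex ^ 'a)"
proof -
  have "pairwise orthogonal B"
    using assms by (auto simp: pairwise_def orthogonal_def orthonormal_def simp flip: Re_cin)
  moreover have "0 \<notin> B"
    using orthonormal_norm[OF assms, of 0] by auto
  ultimately have "independent B" by (rule pairwise_orthogonal_independent)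
  then show ?thesis using independent_bound by blast
qed

text \<open>Take a largest orthonormal set of eigenvectors in \<open>W\<close>. Its orthogonal
  complement in \<open>W\<close> is invariant because \<open>A\<close> is Hermitian, so a nonzero
  complement would contain one more eigenvector. The version for an invariant subspace serves both
  the whole space and the vectors of a region.\<close>

lemma spectral_theorem_subspace:
  fixes A :: "complex ^ 'a::finite ^ 'a"
  assumes A: "hermitian_mat A" and W: "vec.subspace W" and inv: "\<And>v. v \<in> W \<Longrightarrow> A *v v \<in> W"
  obtains B where "B \<subseteq> W" "orthonormal B (\<lambda>b. b)" "\<And>b. b \<in> B \<Longrightarrow> \<exists>e. A *v b = e *s b"
    "\<And>v. v \<in> W \<Longrightarrow> (\<Sum>b\<in>B. cin b v *s b) = v"
proof -
  let ?P = "\<lambda>B. B \<subseteq> W \<and> orthonormal B (\<lambda>b. b) \<and> (\<forall>b\<in>B. \<exists>e. A *v b = e *s b)"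
  have "?P {}" by (simp add: orthonormal_def)
  moreover have "\<forall>B. ?P B \<longrightarrow> card B < Suc (DIM(complex ^ 'a))"
    using orthonormal_card_le by (auto simp: less_Suc_eq_le)
  ultimately obtain B where B: "?P B" and max: "\<And>C. ?P C \<Longrightarrow> card C \<le> card B"
    using ex_has_greatest_nat[of ?P "{}" card "Suc (DIM(complex ^ 'a))"] by blast
  have on: "orthonormal B (\<lambda>b. b)" and fin: "finite B" using B by (auto simp: orthonormal_def)
  have "(\<Sum>b\<in>B. cin b v *s b) = v" if v: "v \<in> W" for v
  proof (rule ccontr)
    assume ne: "(\<Sum>b\<in>B. cin b v *s b) \<noteq> v"
    define V where "V = {u \<in> W. \<forall>b\<in>B. cin b u = 0}"
    have "vec.subspace V"
      using W by (auto simp: V_def vec.subspace_def cin_add_right cin_scale_right)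
    moreover have "A *v u \<in> V" if "u \<in> V" for u
    proof -
      have "cin b (A *v u) = 0" if b: "b \<in> B" for b
      proof -
        obtain e where "A *v b = e *s b" using B b by blast
        then show ?thesis using \<open>u \<in> V\<close> b
          by (simp add: hermitian_cin[OF A, symmetric] cin_scale_left V_def)
      qed
      then show ?thesis using that inv by (auto simp: V_def)
    qed
    moreover have vV: "v - (\<Sum>b\<in>B. cin b v *s b) \<in> V"
    proof -
      have "v - (\<Sum>b\<in>B. cin b v *s b) \<in> W"
        using B v W by (intro vec.subspace_diff[OF W] vec.subspace_sum[OF W] vec.subspace_scale[OF W]) auto
      then show ?thesis
        by (auto simp: V_def cin_diff_right cin_orthonormal_sum[OF on])
    qed
    ultimately obtain u e where u: "u \<in> V" "norm u = 1" "A *v u = e *s u"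
      using hermitian_eigenvector_in_subspace[OF A, of V, OF _ _ vV] ne by auto
    have uB: "u \<notin> B" using u orthonormal_norm[OF on]
      by (auto simp: V_def cin_self)
    have bu: "cin b u = 0" "cin u b = 0" if "b \<in> B" for b
      using u that cin_cnj[of b u] by (auto simp: V_def)
    have "?P (insert u B)"
      using B u uB bu fin by (auto simp: orthonormal_def V_def cin_self)
    from max[OF this] show False using uB fin by simp
  qed
  moreover have "B \<subseteq> W" "\<And>b. b \<in> B \<Longrightarrow> \<exists>e. A *v b = e *s b"
    using B by auto
  ultimately show ?thesis using that[of B] on by presburger
qed

subsection \<open>Matrices as a Hilbert space\<close>

definition outer :: "complex ^ 'a::finite \<Rightarrow> complex ^ 'a \<Rightarrow> complex ^ 'a ^ 'a" where
  "outer u v = (\<chi> i j. u $ i * cnj (v $ j))"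

text \<open>The Hilbert-Schmidt product, the trace of M^* N. Its real part is
  \<open>\<bullet>\<close> on matrices and its norm is the built-in \<open>norm\<close>.\<close>

definition hs :: "complex ^ 'a::finite ^ 'a \<Rightarrow> complex ^ 'a ^ 'a \<Rightarrow> complex" where
  "hs M N = (\<Sum>i\<in>UNIV. \<Sum>j\<in>UNIV. cnj (M $ i $ j) * N $ i $ j)"

lemma outer_mult_vec: "outer u v *v w = cin v w *s u"
  by (simp add: vec_eq_iff outer_def matrix_vector_mult_def cin_def sum_distrib_left sum_distrib_right mult_ac)

lemma scale_mat_nth: "scale_mat c M $ i $ j = c * M $ i $ j"
  by (simp add: scale_mat_def)

lemma scale_mat_scale_mat: "scale_mat c (scale_mat d A) = scale_mat (c * d) A"
  by (simp add: vec_eq_iff scale_mat_def mult_ac)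

lemma scale_mat_mult_vec: "scale_mat c A *v w = c *s (A *v w)"
  by (simp add: vec_eq_iff scale_mat_def matrix_vector_mult_def sum_distrib_left mult_ac)

lemma scale_mat_of_real: "scale_mat (complex_of_real r) A = r *\<^sub>R A"
  by (simp add: vec_eq_iff scale_mat_def scaleR_conv_of_real[where 'a = complex])

lemma scale_mat_scaleR: "scale_mat (r *\<^sub>R c) A = r *\<^sub>R scale_mat c A"
  by (simp add: vec_eq_iff scale_mat_def)

lemma scale_mat_0 [simp]: "scale_mat 0 A = 0"
  by (simp add: vec_eq_iff scale_mat_def)

lemma sum_mult_vec: "sum f L *v w = (\<Sum>l\<in>L. f l *v w)" for w :: "complex ^ 'a::finite"
  by (induction L rule: infinite_finite_induct) (simp_all add: matrix_vector_mult_add_rdistrib)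

lemma Re_hs: "Re (hs M N) = M \<bullet> N"
  by (simp add: hs_def inner_vec_def inner_complex_def)

lemma hs_cnj: "cnj (hs M N) = hs N M"
  by (simp add: hs_def mult.commute)

lemma hs_add_right: "hs M (N + N') = hs M N + hs M N'"
  by (simp add: hs_def algebra_simps sum.distrib)

lemma hs_sum_right: "hs M (sum f L) = (\<Sum>l\<in>L. hs M (f l))"
proof (induction L rule: infinite_finite_induct)
  case empty then show ?case by (simp add: hs_def)
next
  case infinite then show ?case by (simp add: hs_def)
qed (simp add: hs_add_right)

lemma hs_scale_right: "hs M (scale_mat c N) = c * hs M N"
  by (simp add: hs_def scale_mat_def sum_distrib_left mult_ac)

lemma hs_scale_left: "hs (scale_mat c M) N = cnj c * hs M N"
  by (simp add: hs_def scale_mat_def sum_distrib_left mult_ac)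

lemma hs_self: "hs M M = of_real ((norm M)\<^sup>2)"
proof -
  have "Im (hs M M) = 0"
    using arg_cong[OF hs_cnj[of M M], of Im] by simp
  then show ?thesis
    by (simp add: complex_eq_iff Re_hs power2_norm_eq_inner)
qed

lemma norm_scale_mat: "norm (scale_mat c M) = cmod c * norm (M :: complex ^ 'a::finite ^ 'a)"
proof -
  have "of_real ((norm (scale_mat c M))\<^sup>2) = (of_real ((cmod c * norm M)\<^sup>2) :: complex)"
    unfolding hs_self[symmetric] hs_scale_left hs_scale_right
    using complex_norm_square[of c] by (simp add: hs_self power_mult_distrib)
  then have "(norm (scale_mat c M))\<^sup>2 = (cmod c * norm M)\<^sup>2"
    using of_real_eq_iff by blast
  then show ?thesis by (simp add: power2_eq_iff_nonneg)
qed

lemma hs_outer_right: "hs M (outer u v) = cnj (cin u (M *v v))"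
  by (simp add: hs_def outer_def cin_def matrix_vector_mult_def sum_distrib_left mult_ac)

lemma inner_outer: "outer u v \<bullet> M = Re (cin u (M *v v))"
  by (subst inner_commute) (simp flip: Re_hs add: hs_outer_right)

section \<open>Operators expanded in an orthonormal basis\<close>

lemma mat_eq_onbI:
  fixes M N :: "complex ^ 'a::finite ^ 'a"
  assumes "onb L a" "\<And>l. l \<in> L \<Longrightarrow> M *v a l = N *v a l"
  shows "M = N"
proof -
  have "M *v v = N *v v" for v
  proof -
    have "M *v (\<Sum>l\<in>L. cin (a l) v *s a l) = N *v (\<Sum>l\<in>L. cin (a l) v *s a l)"
      unfolding matvec_sum matvec_smult using assms(2) by (intro sum.cong) auto
    then show ?thesis by (simp add: onb_expand[OF assms(1)])
  qed
  then show ?thesis by (simp add: matrix_eq)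
qed

lemma sum_outer_self_mult:
  assumes "orthonormal L a" "l \<in> L"
  shows "(\<Sum>m\<in>L. scale_mat (f m) (outer (a m) (a m))) *v a l = f l *s a l"
proof -
  have "(\<Sum>m\<in>L. scale_mat (f m) (outer (a m) (a m))) *v a l
      = (\<Sum>m\<in>L. if m = l then f l *s a l else 0)"
    unfolding sum_mult_vec scale_mat_mult_vec outer_mult_vec
    by (intro sum.cong refl) (simp add: orthonormalD[OF assms(1) _ assms(2)] vec_eq_iff)
  then show ?thesis using assms orthonormal_finite[OF assms(1)] by simp
qed

lemma onb_mat_expand:
  assumes "onb L a"
  shows "(\<Sum>l\<in>L. \<Sum>m\<in>L. scale_mat (cin (a l) (M *v a m)) (outer (a l) (a m))) = M"
proof (rule mat_eq_onbI[OF assms])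
  fix k assume k: "k \<in> L"
  note on = onb_orthonormal[OF assms]
  have "(\<Sum>m\<in>L. scale_mat (cin (a l) (M *v a m)) (outer (a l) (a m))) *v a k
      = cin (a l) (M *v a k) *s a l" for l
  proof -
    have "(\<Sum>m\<in>L. scale_mat (cin (a l) (M *v a m)) (outer (a l) (a m))) *v a k
      = (\<Sum>m\<in>L. if m = k then cin (a l) (M *v a k) *s a l else 0)"
      unfolding sum_mult_vec scale_mat_mult_vec outer_mult_vec
      by (intro sum.cong refl) (simp add: orthonormalD[OF on _ k])
    then show ?thesis using k orthonormal_finite[OF on] by simp
  qed
  then show "(\<Sum>l\<in>L. \<Sum>m\<in>L. scale_mat (cin (a l) (M *v a m)) (outer (a l) (a m))) *v a k = M *v a k"
    by (simp add: sum_mult_vec[of _ L] onb_expand[OF assms])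
qed

lemma onb_hs:
  assumes "onb L a"
  shows "hs M N = (\<Sum>l\<in>L. \<Sum>m\<in>L. cnj (cin (a l) (M *v a m)) * cin (a l) (N *v a m))"
proof -
  have "hs M N = hs M (\<Sum>l\<in>L. \<Sum>m\<in>L. scale_mat (cin (a l) (N *v a m)) (outer (a l) (a m)))"
    by (simp only: onb_mat_expand[OF assms])
  then show ?thesis
    by (simp add: hs_sum_right hs_scale_right hs_outer_right mult.commute)
qed

lemma onb_norm_mat:
  assumes "onb L a"
  shows "(norm M)\<^sup>2 = (\<Sum>l\<in>L. \<Sum>m\<in>L. (cmod (cin (a l) (M *v a m)))\<^sup>2)"
proof -
  have "complex_of_real ((norm M)\<^sup>2) = of_real (\<Sum>l\<in>L. \<Sum>m\<in>L. (cmod (cin (a l) (M *v a m)))\<^sup>2)"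
    unfolding hs_self[symmetric] onb_hs[OF assms, of M M]
    by (simp add: complex_norm_square mult.commute del: of_real_power)
  then show ?thesis using of_real_eq_iff by blast
qed

subsection \<open>Operator norm\<close>

lemma opnorm_bound: "norm (A *v v) \<le> opnorm A * norm v"
  unfolding opnorm_def by (rule onorm[OF bounded_linear_matvec])

lemma opnorm_leI: "(\<And>v. norm (A *v v) \<le> c * norm v) \<Longrightarrow> opnorm A \<le> c"
  unfolding opnorm_def by (rule onorm_le)

lemma opnorm_nonneg: "0 \<le> opnorm A"
  unfolding opnorm_def by (rule onorm_pos_le[OF bounded_linear_matvec])

lemma opnorm_triangle: "opnorm (A + B) \<le> opnorm A + opnorm B"
proof (rule opnorm_leI)
  fix v
  have "norm ((A + B) *v v) \<le> norm (A *v v) + norm (B *v v)"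
    by (simp add: matrix_vector_mult_add_rdistrib norm_triangle_ineq)
  also have "\<dots> \<le> (opnorm A + opnorm B) * norm v"
    using opnorm_bound[of A v] opnorm_bound[of B v] by (simp add: algebra_simps)
  finally show "norm ((A + B) *v v) \<le> (opnorm A + opnorm B) * norm v" .
qed

lemma norm_mat_sq: "(norm (M :: complex ^ 'a::finite ^ 'a))\<^sup>2 = (\<Sum>i\<in>UNIV. \<Sum>j\<in>UNIV. (cmod (M $ i $ j))\<^sup>2)"
  by (simp add: norm_vec_def L2_set_def sum_nonneg)

lemma norm_vec_sq: "(norm (v :: complex ^ 'a::finite))\<^sup>2 = (\<Sum>i\<in>UNIV. (cmod (v $ i))\<^sup>2)"
  by (simp add: norm_vec_def L2_set_def sum_nonneg)

lemma opnorm_le_norm: "opnorm A \<le> norm A"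
proof (rule opnorm_leI)
  fix v :: "complex ^ 'a"
  have "(norm (A *v v))\<^sup>2 \<le> (\<Sum>i\<in>UNIV. (norm (A $ i))\<^sup>2 * (norm v)\<^sup>2)"
    unfolding norm_vec_sq[of "A *v v"]
  proof (rule sum_mono)
    fix i
    have "(A *v v) $ i = cin (\<chi> j. cnj (A $ i $ j)) v"
      by (simp add: matrix_vector_mult_def cin_def)
    then have "cmod ((A *v v) $ i) \<le> norm (\<chi> j. cnj (A $ i $ j)) * norm v"
      by (simp only: cmod_cin_le)
    also have "norm (\<chi> j. cnj (A $ i $ j)) = norm (A $ i)"
      by (simp add: norm_vec_def)
    finally show "(cmod ((A *v v) $ i))\<^sup>2 \<le> (norm (A $ i))\<^sup>2 * (norm v)\<^sup>2"
      by (metis norm_ge_zero power_mono power_mult_distrib)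
  qed
  also have "\<dots> = (norm A * norm v)\<^sup>2"
    by (simp add: power_mult_distrib norm_vec_def[of A] L2_set_def sum_nonneg sum_distrib_right)
  finally show "norm (A *v v) \<le> norm A * norm v"
    by (simp add: power2_le_iff_abs_le)
qed

text \<open>Each column is the image of a unit vector. The dimension factor paid here, divided by
  the gain of d^|S^c| from the restriction map, is the origin of d^|S| in the theorem.\<close>

lemma norm_sq_le_opnorm:
  "(norm (A :: complex ^ 'a::finite ^ 'a))\<^sup>2 \<le> CARD('a) * (opnorm A)\<^sup>2"
proof -
  have "(norm A)\<^sup>2 = (\<Sum>j\<in>UNIV. (norm (A *v axis j 1))\<^sup>2)"
    unfolding norm_mat_sq norm_vec_sq
    by (subst sum.swap) (simp add: matrix_vector_mult_def axis_def if_distrib cong: if_cong)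
  also have "\<dots> \<le> (\<Sum>j\<in>(UNIV :: 'a set). (opnorm A)\<^sup>2)"
  proof (rule sum_mono)
    fix j :: 'a
    have "norm (A *v axis j 1) \<le> opnorm A"
      using opnorm_bound[of A "axis j 1"] by simp
    then show "(norm (A *v axis j 1))\<^sup>2 \<le> (opnorm A)\<^sup>2"
      by (intro power_mono) auto
  qed
  finally show ?thesis by simp
qed

text \<open>The reverse triangle inequality together with \<open>opnorm_le_norm\<close> makes the
  operator norm 1-Lipschitz for the Hilbert-Schmidt norm.\<close>

lemma continuous_on_opnorm: "continuous_on UNIV (opnorm :: complex ^ 'a::finite ^ 'a \<Rightarrow> real)"
proof -
  have "1-lipschitz_on UNIV (opnorm :: complex ^ 'a::finite ^ 'a \<Rightarrow> real)"
  proof (rule lipschitz_onI)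
    fix A B :: "complex ^ 'a ^ 'a"
    have "opnorm A \<le> opnorm (A - B) + opnorm B" "opnorm B \<le> opnorm (B - A) + opnorm A"
      using opnorm_triangle[of "A - B" B] opnorm_triangle[of "B - A" A] by auto
    then show "dist (opnorm A) (opnorm B) \<le> 1 * dist A B"
      using opnorm_le_norm[of "A - B"] opnorm_le_norm[of "B - A"]
      by (simp add: dist_norm norm_minus_commute)
  qed simp
  then show ?thesis by (rule lipschitz_on_continuous_on)
qed

lemma opnorm_0 [simp]: "opnorm (0 :: complex ^ 'a::finite ^ 'a) = 0"
  using opnorm_le_norm[of "0 :: complex ^ 'a ^ 'a"] opnorm_nonneg[of "0 :: complex ^ 'a ^ 'a"]
  by simp

subsection \<open>Heisenberg evolution in an eigenbasis\<close>

lemma bounded_linear_scale_mat: "bounded_linear (\<lambda>c. scale_mat c (M :: complex ^ 'a::finite ^ 'a))"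
  by (intro linear_conv_bounded_linear[THEN iffD1] linearI)
    (simp_all add: vec_eq_iff scale_mat_def algebra_simps)

text \<open>Writing every power in spectral form reduces the matrix series to finitely many scalar
  exponential series, which settles its convergence and its value together.\<close>

lemma mat_exp_eigenvector:
  fixes A :: "complex ^ 'a::finite ^ 'a"
  assumes onb: "onb L a" and eig: "\<And>l. l \<in> L \<Longrightarrow> A *v a l = \<mu> l *s a l" and l: "l \<in> L"
  shows "mat_exp A *v a l = exp (\<mu> l) *s a l"
proof -
  note on = onb_orthonormal[OF onb]
  have "mat_power A n *v a l = \<mu> l ^ n *s a l" if "l \<in> L" for n l
    by (induction n) (simp_all add: matrix_vector_mul_assoc[symmetric] matvec_smult eig that mult.commute)
  then have pow: "mat_power A n = (\<Sum>m\<in>L. scale_mat (\<mu> m ^ n) (outer (a m) (a m)))" for n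
    by (intro mat_eq_onbI[OF onb]) (simp add: sum_outer_self_mult[OF on])
  have "(\<lambda>n. \<Sum>m\<in>L. scale_mat (\<mu> m ^ n /\<^sub>R fact n) (outer (a m) (a m))) sums
      (\<Sum>m\<in>L. scale_mat (exp (\<mu> m)) (outer (a m) (a m)))"
    by (intro sums_sum bounded_linear.sums[OF bounded_linear_scale_mat] exp_converges)
  also have "(\<lambda>n. \<Sum>m\<in>L. scale_mat (\<mu> m ^ n /\<^sub>R fact n) (outer (a m) (a m)))
      = (\<lambda>n. (1 / fact n) *\<^sub>R mat_power A n)"
    by (simp only: pow scaleR_sum_right scale_mat_scaleR divide_inverse_commute mult_1_right)
  finally have "mat_exp A = (\<Sum>m\<in>L. scale_mat (exp (\<mu> m)) (outer (a m) (a m)))"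
    unfolding mat_exp_def by (simp add: sums_iff)
  then show ?thesis by (simp add: sum_outer_self_mult[OF on l])
qed

lemma cin_diagonal:
  fixes U :: "complex ^ 'a::finite ^ 'a"
  assumes onb: "onb L a" and eig: "\<And>l. l \<in> L \<Longrightarrow> U *v a l = \<phi> l *s a l" and l: "l \<in> L"
  shows "cin (a l) (U *v v) = \<phi> l * cin (a l) v"
proof -
  have "U *v v = U *v (\<Sum>m\<in>L. cin (a m) v *s a m)"
    by (simp add: onb_expand[OF onb])
  also have "\<dots> = (\<Sum>m\<in>L. (\<phi> m * cin (a m) v) *s a m)"
    unfolding matvec_sum matvec_smult by (intro sum.cong refl) (simp add: eig vec_eq_iff mult_ac)
  finally show ?thesis
    by (simp only: cin_orthonormal_sum[OF onb_orthonormal[OF onb] l])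
qed

locale eigenbasis =
  fixes H :: "('x::finite, 'd::finite) observable" and L :: "'l set"
    and a :: "'l \<Rightarrow> complex ^ ('x \<Rightarrow> 'd)" and E :: "'l \<Rightarrow> real"
  assumes onb: "onb L a"
    and eig: "l \<in> L \<Longrightarrow> H *v a l = of_real (E l) *s a l"
begin

lemma mat_exp_eig:
  "l \<in> L \<Longrightarrow> mat_exp (scale_mat c H) *v a l = exp (c * E l) *s a l"
  by (rule mat_exp_eigenvector[OF onb])
    (simp_all add: scale_mat_mult_vec eig vec_eq_iff mult_ac)

lemma coef_heisenberg:
  assumes l: "l \<in> L" and m: "m \<in> L"
  shows "cin (a l) (heisenberg H M t *v a m) = cis (t * (E l - E m)) * cin (a l) (M *v a m)"
proof -
  have "heisenberg H M t *v a m
      = mat_exp (scale_mat (\<i> * t) H) *v (exp (- \<i> * t * E m) *s (M *v a m))"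
    by (simp add: heisenberg_def matrix_vector_mul_assoc[symmetric] mat_exp_eig[OF m] matvec_smult)
  then have "cin (a l) (heisenberg H M t *v a m)
      = exp (\<i> * t * E l) * (exp (- \<i> * t * E m) * cin (a l) (M *v a m))"
    by (simp only: cin_diagonal[OF onb mat_exp_eig l] cin_scale_right)
  also have "\<dots> = exp (\<i> * t * E l + - \<i> * t * E m) * cin (a l) (M *v a m)"
    by (simp only: exp_add mult.assoc)
  also have "\<i> * t * E l + - \<i> * t * E m = \<i> * complex_of_real (t * (E l - E m))"
    by (simp add: algebra_simps)
  finally show ?thesis by (simp only: cis_conv_exp)
qed

lemma heisenberg_expand:
  "heisenberg H M t = (\<Sum>l\<in>L. \<Sum>m\<in>L.
     scale_mat (cis (t * (E l - E m)) * cin (a l) (M *v a m)) (outer (a l) (a m)))"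
  by (subst onb_mat_expand[OF onb, symmetric], intro sum.cong refl) (simp add: coef_heisenberg)

text \<open>In the energy basis the evolution only multiplies matrix entries by phases; carrying a
  phase to the other side of the product conjugates it, that is, reverses time.\<close>

lemma inner_heisenberg: "heisenberg H M t \<bullet> N = M \<bullet> heisenberg H N (- t)"
proof -
  have "hs (heisenberg H M t) N = hs M (heisenberg H N (- t))"
    unfolding onb_hs[OF onb]
    by (intro sum.cong refl) (simp add: coef_heisenberg cis_cnj mult_ac)
  then show ?thesis by (metis Re_hs)
qed

lemma heisenberg_heisenberg_minus: "heisenberg H (heisenberg H M t) (- t) = M"
  by (rule mat_eq_onbI[OF onb], rule onb_eqI[OF onb])
    (simp add: coef_heisenberg cis_mult flip: mult.assoc)

lemma heisenberg_one: "heisenberg H (mat 1) t = mat 1"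
proof (rule mat_eq_onbI[OF onb], rule onb_eqI[OF onb])
  fix l m assume "l \<in> L" "m \<in> L"
  then show "cin (a l) (heisenberg H (mat 1) t *v a m) = cin (a l) (mat 1 *v a m)"
    using orthonormalD[OF onb_orthonormal[OF onb], of l m] by (simp add: coef_heisenberg)
qed

lemma norm_mat_exp_mult: "norm (mat_exp (scale_mat (\<i> * of_real t) H) *v v) = norm v"
proof -
  have "(norm (mat_exp (scale_mat (\<i> * of_real t) H) *v v))\<^sup>2 = (norm v)\<^sup>2"
    unfolding onb_norm[OF onb] 
    by (intro sum.cong refl) (simp add: cin_diagonal[OF onb mat_exp_eig] norm_mult)
  then show ?thesis by (simp add: power2_eq_iff_nonneg)
qed

lemma opnorm_heisenberg_le: "opnorm (heisenberg H M t) \<le> opnorm M"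
proof (rule opnorm_leI)
  fix v
  let ?w = "mat_exp (scale_mat (\<i> * of_real (- t)) H) *v v"
  have "norm (heisenberg H M t *v v) = norm (M *v ?w)"
    by (simp add: heisenberg_def matrix_vector_mul_assoc[symmetric] norm_mat_exp_mult)
  also have "\<dots> \<le> opnorm M * norm ?w" by (rule opnorm_bound)
  also have "norm ?w = norm v" by (rule norm_mat_exp_mult)
  finally show "norm (heisenberg H M t *v v) \<le> opnorm M * norm v" .
qed

end

subsection \<open>Configurations of a region and its complement\<close>

abbreviation confs :: "'x set \<Rightarrow> ('x \<Rightarrow> 'd) set" where
  "confs S \<equiv> S \<rightarrow>\<^sub>E UNIV"

abbreviation glue :: "'x set \<Rightarrow> ('x \<Rightarrow> 'd) \<Rightarrow> ('x \<Rightarrow> 'd) \<Rightarrow> 'x \<Rightarrow> 'd" where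
  "glue S \<alpha> \<eta> \<equiv> override_on \<alpha> \<eta> (-S)"

lemma finite_confs [simp]: "finite (confs S :: ('x::finite \<Rightarrow> 'd::finite) set)"
  by (intro finite_PiE) auto

lemma card_confs: "card (confs S :: ('x::finite \<Rightarrow> 'd::finite) set) = CARD('d) ^ card S"
  by (simp add: card_PiE)

lemma restrict_glue [simp]: "\<alpha> \<in> confs S \<Longrightarrow> restrict (glue S \<alpha> \<eta>) S = \<alpha>"
  by (auto simp: fun_eq_iff override_on_def PiE_def extensional_def)

lemma glue_restrict [simp]: "glue S (restrict \<sigma> S) \<eta> = glue S \<sigma> \<eta>"
  by (auto simp: fun_eq_iff override_on_def)

lemma conf_eq_iff:
  assumes "\<eta> \<in> confs (-S)" "\<eta>' \<in> confs (-S)"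
  shows "(\<forall>x\<in>-S. \<eta> x = \<eta>' x) \<longleftrightarrow> \<eta> = \<eta>'"
  using PiE_ext[OF assms] by auto

lemma glue_inject:
  assumes "\<alpha> \<in> confs S" "\<beta> \<in> confs S" "\<eta> \<in> confs (-S)" "\<eta>' \<in> confs (-S)"
  shows "glue S \<alpha> \<eta> = glue S \<beta> \<eta>' \<longleftrightarrow> \<alpha> = \<beta> \<and> \<eta> = \<eta>'"
proof
  assume *: "glue S \<alpha> \<eta> = glue S \<beta> \<eta>'"
  have "\<forall>x\<in>-S. \<eta> x = \<eta>' x"
    using fun_cong[OF *] by (metis override_on_apply_in)
  moreover have "\<alpha> = \<beta>" using assms(1,2) * by (metis restrict_glue)
  ultimately show "\<alpha> = \<beta> \<and> \<eta> = \<eta>'" using conf_eq_iff assms by blast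
qed auto

lemma glue_restrict_restrict: "glue S (restrict \<sigma> S) (restrict \<sigma> (-S)) = \<sigma>"
  by (auto simp: fun_eq_iff override_on_def)

lemma glue_surj: obtains \<alpha> \<eta> where "\<alpha> \<in> confs S" "\<eta> \<in> confs (-S)" "\<sigma> = glue S \<alpha> \<eta>"
proof
  show "\<sigma> = glue S (restrict \<sigma> S) (restrict \<sigma> (-S))"
    by (rule glue_restrict_restrict[symmetric])
qed auto

text \<open>The bijection between configurations of the lattice and pairs of configurations of
  \<open>S\<close> and its complement; it plays the role of the tensor factorisation
  throughout.\<close>

lemma sum_glue:
  fixes h :: "('x::finite \<Rightarrow> 'd::finite) \<Rightarrow> 'b::comm_monoid_add"
  shows "(\<Sum>\<sigma>\<in>UNIV. h \<sigma>) = (\<Sum>\<alpha>\<in>confs S. \<Sum>\<eta>\<in>confs (-S). h (glue S \<alpha> \<eta>))"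
proof -
  have "(\<Sum>\<sigma>\<in>UNIV. h \<sigma>) = (\<Sum>p\<in>confs S \<times> confs (-S). h (glue S (fst p) (snd p)))"
  proof (rule sum.reindex_bij_witness[where
        i = "\<lambda>p. glue S (fst p) (snd p)" and j = "\<lambda>\<sigma>. (restrict \<sigma> S, restrict \<sigma> (-S))"])
    fix p :: "('x \<Rightarrow> 'd) \<times> ('x \<Rightarrow> 'd)"
    assume p: "p \<in> confs S \<times> confs (-S)"
    then have "restrict (glue S (fst p) (snd p)) (-S) = snd p"
      by (auto simp: fun_eq_iff override_on_def PiE_def extensional_def)
    then show "(restrict (glue S (fst p) (snd p)) S, restrict (glue S (fst p) (snd p)) (-S)) = p"
      using p by auto
  qed (auto simp: glue_restrict_restrict simp del: glue_restrict)
  then show ?thesis by (simp add: sum.cartesian_product case_prod_unfold)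
qed

lemma tensor_id_glue:
  assumes "\<alpha> \<in> confs S" "\<beta> \<in> confs S" "\<eta> \<in> confs (-S)" "\<eta>' \<in> confs (-S)"
  shows "tensor_id S B $ glue S \<alpha> \<eta> $ glue S \<beta> \<eta>' = (if \<eta> = \<eta>' then B \<alpha> \<beta> else 0)"
  using assms by (simp add: tensor_id_def conf_eq_iff)

lemma mat_eq_glueI:
  fixes M N :: "('x::finite, 'd::finite) observable"
  assumes "\<And>\<alpha> \<beta> \<eta> \<eta>'. \<alpha> \<in> confs S \<Longrightarrow> \<beta> \<in> confs S \<Longrightarrow> \<eta> \<in> confs (-S) \<Longrightarrow> \<eta>' \<in> confs (-S) \<Longrightarrow>
    M $ glue S \<alpha> \<eta> $ glue S \<beta> \<eta>' = N $ glue S \<alpha> \<eta> $ glue S \<beta> \<eta>'"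
  shows "M = N"
proof -
  have "M $ \<sigma> $ \<tau> = N $ \<sigma> $ \<tau>" for \<sigma> \<tau>
    by (metis assms glue_surj)
  then show ?thesis by (simp add: vec_eq_iff)
qed

lemma vec_eq_glueI:
  fixes u v :: "complex ^ ('x::finite \<Rightarrow> 'd::finite)"
  assumes "\<And>\<alpha> \<eta>. \<alpha> \<in> confs S \<Longrightarrow> \<eta> \<in> confs (-S) \<Longrightarrow> u $ glue S \<alpha> \<eta> = v $ glue S \<alpha> \<eta>"
  shows "u = v"
proof -
  have "u $ \<sigma> = v $ \<sigma>" for \<sigma>
    by (metis assms glue_surj)
  then show ?thesis by (simp add: vec_eq_iff)
qed

subsection \<open>The restriction map\<close>

lemma restriction_map_glue:
  fixes M :: "('x::finite, 'd::finite) observable"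
  assumes "\<alpha> \<in> confs S" "\<beta> \<in> confs S" "\<eta> \<in> confs (-S)" "\<eta>' \<in> confs (-S)"
  shows "restriction_map S M $ glue S \<alpha> \<eta> $ glue S \<beta> \<eta>'
    = (if \<eta> = \<eta>' then partial_trace (-S) M \<alpha> \<beta> / CARD('d) ^ card (-S) else 0)"
  using assms by (simp add: restriction_map_def scale_mat_def tensor_id_glue)

lemma partial_trace_add: "partial_trace R (M + N) \<alpha> \<beta> = partial_trace R M \<alpha> \<beta> + partial_trace R N \<alpha> \<beta>"
  by (simp add: partial_trace_def sum.distrib)

lemma partial_trace_scale: "partial_trace R (scale_mat c M) \<alpha> \<beta> = c * partial_trace R M \<alpha> \<beta>"
  by (simp add: partial_trace_def scale_mat_def sum_distrib_left)

lemma restriction_map_add: "restriction_map S (M + N) = restriction_map S M + restriction_map S N"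
  by (rule mat_eq_glueI[of S]) (simp add: restriction_map_glue partial_trace_add add_divide_distrib)

lemma restriction_map_scale: "restriction_map S (scale_mat c M) = scale_mat c (restriction_map S M)"
  by (rule mat_eq_glueI[of S]) (simp add: restriction_map_glue partial_trace_scale scale_mat_nth)

lemma restriction_map_zero: "restriction_map S 0 = 0"
  using restriction_map_scale[of S 0 0] by simp

lemma restriction_map_sum: "restriction_map S (sum f L) = (\<Sum>l\<in>L. restriction_map S (f l))"
  by (induction L rule: infinite_finite_induct) (simp_all add: restriction_map_add restriction_map_zero)

lemma bounded_linear_restriction_map: "bounded_linear (restriction_map S)"
  by (intro linear_conv_bounded_linear[THEN iffD1] linearI)
    (simp_all add: restriction_map_add restriction_map_scale flip: scale_mat_of_real)

text \<open>The identity factor on the complement forces \<open>\<eta> = \<eta>'\<close>, and the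
  remaining sum over \<open>\<eta>\<close> is the partial trace of \<open>N\<close>. The result is
  symmetric in \<open>M\<close> and \<open>N\<close> up to conjugation, whence the self-adjointness
  of the restriction map.\<close>

lemma hs_restriction_map:
  fixes M N :: "('x::finite, 'd::finite) observable"
  shows "hs (restriction_map S M) N
    = (\<Sum>\<alpha>\<in>confs S. \<Sum>\<beta>\<in>confs S. cnj (partial_trace (-S) M \<alpha> \<beta>) * partial_trace (-S) N \<alpha> \<beta>)
        / CARD('d) ^ card (-S)"
proof -
  have "hs (restriction_map S M) N = (\<Sum>\<alpha>\<in>confs S. \<Sum>\<eta>\<in>confs (-S). \<Sum>\<beta>\<in>confs S. \<Sum>\<eta>'\<in>confs (-S).
      cnj (restriction_map S M $ glue S \<alpha> \<eta> $ glue S \<beta> \<eta>') * N $ glue S \<alpha> \<eta> $ glue S \<beta> \<eta>')"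
    unfolding hs_def by (simp only: sum_glue[of _ S])
  also have "\<dots> = (\<Sum>\<alpha>\<in>confs S. \<Sum>\<eta>\<in>confs (-S). \<Sum>\<beta>\<in>confs S. \<Sum>\<eta>'\<in>confs (-S).
      if \<eta> = \<eta>' then cnj (partial_trace (-S) M \<alpha> \<beta>) / CARD('d) ^ card (-S) * N $ glue S \<alpha> \<eta> $ glue S \<beta> \<eta> else 0)"
    by (intro sum.cong refl) (simp add: restriction_map_glue)
  also have "\<dots> = (\<Sum>\<alpha>\<in>confs S. \<Sum>\<eta>\<in>confs (-S). \<Sum>\<beta>\<in>confs S.
      cnj (partial_trace (-S) M \<alpha> \<beta>) / CARD('d) ^ card (-S) * N $ glue S \<alpha> \<eta> $ glue S \<beta> \<eta>)"
    by (intro sum.cong refl) simp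
  also have "\<dots> = (\<Sum>\<alpha>\<in>confs S. \<Sum>\<beta>\<in>confs S. \<Sum>\<eta>\<in>confs (-S).
      cnj (partial_trace (-S) M \<alpha> \<beta>) / CARD('d) ^ card (-S) * N $ glue S \<alpha> \<eta> $ glue S \<beta> \<eta>)"
    by (intro sum.cong refl sum.swap)
  also have "\<dots> = (\<Sum>\<alpha>\<in>confs S. \<Sum>\<beta>\<in>confs S. cnj (partial_trace (-S) M \<alpha> \<beta>) * partial_trace (-S) N \<alpha> \<beta>)
        / CARD('d) ^ card (-S)"
    by (simp add: sum_divide_distrib partial_trace_def[of _ N] sum_distrib_left)
  finally show ?thesis .
qed

lemma inner_restriction_map: "restriction_map S M \<bullet> N = M \<bullet> restriction_map S N"
proof -
  have "hs (restriction_map S M) N = cnj (hs (restriction_map S N) M)"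
    by (simp add: hs_restriction_map mult.commute)
  then show ?thesis by (metis hs_cnj Re_hs)
qed

lemma partial_trace_restriction_map:
  fixes M :: "('x::finite, 'd::finite) observable"
  assumes "\<alpha> \<in> confs S" "\<beta> \<in> confs S"
  shows "partial_trace (-S) (restriction_map S M) \<alpha> \<beta> = partial_trace (-S) M \<alpha> \<beta>"
  unfolding partial_trace_def[of _ "restriction_map S M"]
  using assms by (simp add: restriction_map_glue card_confs)

lemma norm_restriction_map:
  fixes M :: "('x::finite, 'd::finite) observable"
  shows "(norm (restriction_map S M))\<^sup>2
    = (\<Sum>\<alpha>\<in>confs S. \<Sum>\<beta>\<in>confs S. (cmod (partial_trace (-S) M \<alpha> \<beta>))\<^sup>2) / CARD('d) ^ card (-S)"
proof -
  have "complex_of_real ((norm (restriction_map S M))\<^sup>2)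
    = of_real ((\<Sum>\<alpha>\<in>confs S. \<Sum>\<beta>\<in>confs S. (cmod (partial_trace (-S) M \<alpha> \<beta>))\<^sup>2) / CARD('d) ^ card (-S))"
    unfolding hs_self[symmetric] hs_restriction_map[of S M "restriction_map S M"]
    by (simp add: partial_trace_restriction_map mult_cnj_cmod mult.commute)
  then show ?thesis using of_real_eq_iff by blast
qed

text \<open>An entry of the partial trace is a sum over \<open>\<eta>\<close> of products of
  components of \<open>u\<close> and \<open>v\<close>. Cauchy-Schwarz in \<open>\<eta>\<close>
  separates the two vectors, and summing over \<open>\<alpha>\<close> and \<open>\<beta>\<close>
  restores their norms. The full gain d^{-|S^c|} thus comes from the normalisation of the
  restriction map.\<close>

lemma norm_restriction_map_outer:
  fixes u v :: "complex ^ ('x::finite \<Rightarrow> 'd::finite)"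
  assumes "norm u = 1" "norm v = 1"
  shows "(norm (restriction_map S (outer u v)))\<^sup>2 \<le> 1 / CARD('d) ^ card (-S)"
proof -
  define f where "f w \<alpha> = (\<Sum>\<eta>\<in>confs (-S). (cmod (w $ glue S \<alpha> \<eta>))\<^sup>2)"
    for w :: "complex ^ ('x \<Rightarrow> 'd)" and \<alpha>
  have f: "(\<Sum>\<alpha>\<in>confs S. f w \<alpha>) = (norm w)\<^sup>2" for w
    unfolding f_def norm_vec_sq sum_glue[of _ S] ..
  have "(\<Sum>\<alpha>\<in>confs S. \<Sum>\<beta>\<in>confs S. (cmod (partial_trace (-S) (outer u v) \<alpha> \<beta>))\<^sup>2)
      \<le> (\<Sum>\<alpha>\<in>confs S. \<Sum>\<beta>\<in>confs S. f u \<alpha> * f v \<beta>)"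
  proof (intro sum_mono)
    fix \<alpha> \<beta>
    have "cmod (partial_trace (-S) (outer u v) \<alpha> \<beta>)
        \<le> (\<Sum>\<eta>\<in>confs (-S). \<bar>cmod (u $ glue S \<alpha> \<eta>)\<bar> * \<bar>cmod (v $ glue S \<beta> \<eta>)\<bar>)"
      unfolding partial_trace_def by (rule sum_norm_le) (simp add: outer_def norm_mult)
    also have "\<dots> \<le> L2_set (\<lambda>\<eta>. cmod (u $ glue S \<alpha> \<eta>)) (confs (-S))
        * L2_set (\<lambda>\<eta>. cmod (v $ glue S \<beta> \<eta>)) (confs (-S))"
      by (rule L2_set_mult_ineq)
    finally have "(cmod (partial_trace (-S) (outer u v) \<alpha> \<beta>))\<^sup>2
        \<le> (L2_set (\<lambda>\<eta>. cmod (u $ glue S \<alpha> \<eta>)) (confs (-S))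
        * L2_set (\<lambda>\<eta>. cmod (v $ glue S \<beta> \<eta>)) (confs (-S)))\<^sup>2"
      by (intro power_mono) auto
    then show "(cmod (partial_trace (-S) (outer u v) \<alpha> \<beta>))\<^sup>2 \<le> f u \<alpha> * f v \<beta>"
      by (simp add: power_mult_distrib L2_set_def f_def sum_nonneg)
  qed
  also have "\<dots> = 1"
    by (simp add: assms f flip: sum_distrib_left sum_distrib_right)
  finally show ?thesis
    unfolding norm_restriction_map by (intro divide_right_mono) auto
qed

text \<open>On the empty region the restriction map is the normalised trace, and the trace of
  \<open>outer u v\<close> is \<open>cin v u\<close>. This handles the one region with d^|S| <
  2.\<close>

lemma restriction_map_empty_outer:
  fixes u v :: "complex ^ ('x::finite \<Rightarrow> 'd::finite)"
  assumes "cin v u = 0"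
  shows "restriction_map {} (outer u v) = 0"
proof -
  have "partial_trace (-{}) (outer u v) \<alpha> \<beta> = 0" if "\<alpha> \<in> confs {}" "\<beta> \<in> confs {}" for \<alpha> \<beta>
    using that assms
    by (simp add: partial_trace_def outer_def cin_def override_on_def mult.commute)
  then have "(norm (restriction_map {} (outer u v)))\<^sup>2 = 0"
    unfolding norm_restriction_map by simp
  then show ?thesis by simp
qed

lemma restriction_map_one: "restriction_map S (mat 1) = (mat 1 :: ('x::finite, 'd::finite) observable)"
proof (rule mat_eq_glueI[of S])
  fix \<alpha> \<beta> \<eta> \<eta>' :: "'x \<Rightarrow> 'd"
  assume *: "\<alpha> \<in> confs S" "\<beta> \<in> confs S" "\<eta> \<in> confs (-S)" "\<eta>' \<in> confs (-S)"
  have "partial_trace (-S) (mat 1) \<alpha> \<beta> = (\<Sum>\<zeta>\<in>(confs (-S) :: ('x \<Rightarrow> 'd) set). if \<alpha> = \<beta> then 1 else 0)"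
    unfolding partial_trace_def by (intro sum.cong refl) (simp add: mat_def glue_inject *)
  then show "restriction_map S (mat 1) $ glue S \<alpha> \<eta> $ glue S \<beta> \<eta>' = mat 1 $ glue S \<alpha> \<eta> $ glue S \<beta> \<eta>'"
    using * by (simp add: restriction_map_glue card_confs) (auto simp: mat_def glue_inject)
qed

lemma supported_on_one: "supported_on (mat 1) S"
proof -
  have "mat 1 = tensor_id S (\<lambda>\<alpha> \<beta>. if \<alpha> = \<beta> then 1 else 0)"
    by (rule mat_eq_glueI[of S]) (auto simp: mat_def tensor_id_glue glue_inject)
  then show ?thesis by (auto simp: supported_on_def)
qed

subsection \<open>Eigenbases of local operators\<close>

text \<open>Vectors of the region \<open>S\<close> are encoded as vectors of the whole lattice supported on
  \<open>confs S\<close>; then \<open>tens S u \<eta>\<close> is the product vector $u \otimes |\eta\rangle$.\<close>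

definition tens :: "'x set \<Rightarrow> complex ^ ('x::finite \<Rightarrow> 'd::finite) \<Rightarrow> ('x \<Rightarrow> 'd) \<Rightarrow> complex ^ ('x \<Rightarrow> 'd)" where
  "tens S u \<eta> = (\<chi> \<sigma>. if \<forall>x\<in>-S. \<sigma> x = \<eta> x then u $ restrict \<sigma> S else 0)"

definition local_vecs :: "'x set \<Rightarrow> (complex ^ ('x::finite \<Rightarrow> 'd::finite)) set" where
  "local_vecs S = {u. \<forall>\<sigma>. \<sigma> \<notin> confs S \<longrightarrow> u $ \<sigma> = 0}"

lemma tens_smult: "tens S (c *s u) \<eta> = c *s tens S u \<eta>"
  by (simp add: tens_def vec_eq_iff)

lemma tens_glue:
  assumes "\<alpha> \<in> confs S" "\<eta> \<in> confs (-S)" "\<eta>' \<in> confs (-S)"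
  shows "tens S u \<eta> $ glue S \<alpha> \<eta>' = (if \<eta> = \<eta>' then u $ \<alpha> else 0)"
  using assms conf_eq_iff[of \<eta>' S \<eta>] by (auto simp: tens_def)

lemma cin_tens:
  assumes "\<eta> \<in> confs (-S)"
  shows "cin (tens S u \<eta>) v = (\<Sum>\<alpha>\<in>confs S. cnj (u $ \<alpha>) * v $ glue S \<alpha> \<eta>)"
proof -
  have "cin (tens S u \<eta>) v
      = (\<Sum>\<alpha>\<in>confs S. \<Sum>\<eta>'\<in>confs (-S). if \<eta> = \<eta>' then cnj (u $ \<alpha>) * v $ glue S \<alpha> \<eta> else 0)"
    unfolding cin_def sum_glue[of _ S] using assms
    by (intro sum.cong refl) (auto simp: tens_glue)
  then show ?thesis using assms by simp
qed

lemma cin_local_vecs: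
  assumes "u \<in> local_vecs S"
  shows "cin u v = (\<Sum>\<alpha>\<in>confs S. cnj (u $ \<alpha>) * v $ \<alpha>)"
  unfolding cin_def using assms by (intro sum.mono_neutral_right) (auto simp: local_vecs_def)

lemma orthonormal_tens:
  fixes C :: "(complex ^ ('x::finite \<Rightarrow> 'd::finite)) set"
  assumes "orthonormal C (\<lambda>c. c)" "C \<subseteq> local_vecs S"
  shows "orthonormal (C \<times> confs (-S)) (\<lambda>p. tens S (fst p) (snd p))"
proof -
  have "cin (tens S u \<eta>) (tens S v \<eta>') = (if u = v \<and> \<eta> = \<eta>' then 1 else 0)"
    if "u \<in> C" "v \<in> C" "\<eta> \<in> confs (-S)" "\<eta>' \<in> confs (-S)" for u v \<eta> \<eta>'
  proof -
    have "cin (tens S u \<eta>) (tens S v \<eta>') = (if \<eta> = \<eta>' then cin u v else 0)"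
      using that assms(2) by (auto simp: cin_tens tens_glue cin_local_vecs[of u S])
    then show ?thesis
      using orthonormalD[OF assms(1), of u v] that by auto
  qed
  then show ?thesis
    using orthonormal_finite[OF assms(1)] by (auto simp: orthonormal_def)
qed

lemma onb_tens:
  fixes C :: "(complex ^ ('x::finite \<Rightarrow> 'd::finite)) set"
  assumes C: "orthonormal C (\<lambda>c. c)" "C \<subseteq> local_vecs S"
    and complete: "\<And>v. v \<in> local_vecs S \<Longrightarrow> (\<Sum>c\<in>C. cin c v *s c) = v"
  shows "onb (C \<times> confs (-S)) (\<lambda>p. tens S (fst p) (snd p))"
  unfolding onb_def
proof (intro conjI allI orthonormal_tens[OF C])
  fix v :: "complex ^ ('x \<Rightarrow> 'd)"
  \<comment> \<open>The slice of \<open>v\<close> at a fixed configuration \<open>\<eta>\<close> of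
    the complement, read as a vector of the region; completeness is then applied slice by
    slice.\<close>
  define w where "w \<eta> = (\<chi> \<alpha>. if \<alpha> \<in> confs S then v $ glue S \<alpha> \<eta> else 0)" for \<eta>
  have w: "w \<eta> \<in> local_vecs S" for \<eta> by (simp add: w_def local_vecs_def)
  have cw: "cin (tens S c \<eta>) v = cin c (w \<eta>)" if "c \<in> C" "\<eta> \<in> confs (-S)" for c \<eta>
    using that C(2) by (auto simp: cin_tens cin_local_vecs[of c S] w_def)
  have "(\<Sum>p\<in>C \<times> confs (-S). cin (tens S (fst p) (snd p)) v *s tens S (fst p) (snd p))
      = (\<Sum>c\<in>C. \<Sum>\<eta>\<in>confs (-S). cin c (w \<eta>) *s tens S c \<eta>)"
    unfolding sum.cartesian_product case_prod_unfold by (intro sum.cong refl) (auto simp: cw)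
  also have "\<dots> = v"
  proof (rule vec_eq_glueI[of S])
    fix \<alpha> \<eta> :: "'x \<Rightarrow> 'd"
    assume *: "\<alpha> \<in> confs S" "\<eta> \<in> confs (-S)"
    have "(\<Sum>c\<in>C. \<Sum>\<zeta>\<in>confs (-S). cin c (w \<zeta>) *s tens S c \<zeta>) $ glue S \<alpha> \<eta>
        = (\<Sum>c\<in>C. \<Sum>\<zeta>\<in>confs (-S). if \<zeta> = \<eta> then cin c (w \<eta>) * c $ \<alpha> else 0)"
      unfolding sum_component vector_smult_component
      using * by (intro sum.cong refl) (simp add: tens_glue)
    also have "\<dots> = (\<Sum>c\<in>C. cin c (w \<eta>) *s c) $ \<alpha>"
      using * by (simp add: sum_component)
    also have "\<dots> = w \<eta> $ \<alpha>" by (simp only: complete[OF w])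
    also have "\<dots> = v $ glue S \<alpha> \<eta>" using * by (simp add: w_def)
    finally show "(\<Sum>c\<in>C. \<Sum>\<zeta>\<in>confs (-S). cin c (w \<zeta>) *s tens S c \<zeta>) $ glue S \<alpha> \<eta> = v $ glue S \<alpha> \<eta>" .
  qed
  finally show "(\<Sum>p\<in>C \<times> confs (-S). cin (tens S (fst p) (snd p)) v *s tens S (fst p) (snd p)) = v" .
qed

text \<open>The same \<open>\<eta>\<close> occurs on both sides and runs over all configurations of
  the complement, so the sum over \<open>\<eta>\<close> is a resolution of the identity
  there.\<close>

lemma supported_on_sum_outer_tens:
  "supported_on (\<Sum>i\<in>I. \<Sum>\<eta>\<in>confs (-S). outer (tens S (e i) \<eta>) (tens S (f i) \<eta>)) S"
proof -
  have "(\<Sum>i\<in>I. \<Sum>\<eta>\<in>confs (-S). outer (tens S (e i) \<eta>) (tens S (f i) \<eta>))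
      = tensor_id S (\<lambda>\<alpha> \<beta>. \<Sum>i\<in>I. e i $ \<alpha> * cnj (f i $ \<beta>))" (is "?A = ?B")
  proof (rule mat_eq_glueI[of S])
    fix \<alpha> \<beta> \<eta> \<eta>' :: "'a \<Rightarrow> 'b"
    assume *: "\<alpha> \<in> confs S" "\<beta> \<in> confs S" "\<eta> \<in> confs (-S)" "\<eta>' \<in> confs (-S)"
    have "?A $ glue S \<alpha> \<eta> $ glue S \<beta> \<eta>' = (\<Sum>i\<in>I. \<Sum>\<zeta>\<in>confs (-S).
        if \<zeta> = \<eta> then (if \<eta> = \<eta>' then e i $ \<alpha> * cnj (f i $ \<beta>) else 0) else 0)"
      unfolding sum_component using * by (intro sum.cong refl) (simp add: outer_def tens_glue)
    then show "?A $ glue S \<alpha> \<eta> $ glue S \<beta> \<eta>' = ?B $ glue S \<alpha> \<eta> $ glue S \<beta> \<eta>'"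
      using * by (simp add: tensor_id_glue)
  qed
  then show ?thesis by (auto simp: supported_on_def)
qed

lemma hermitian_partial_trace:
  assumes "hermitian_mat M"
  shows "partial_trace R M \<alpha> \<beta> = cnj (partial_trace R M \<beta> \<alpha>)"
proof -
  have "cnj (M $ i $ j) = M $ j $ i" for i j
    using assms by (metis hermitian_mat_def)
  then show ?thesis by (simp add: partial_trace_def)
qed

text \<open>The eigenvalue depends on \<open>c\<close> alone and not on \<open>\<eta>\<close>.
  Eigenvectors can therefore be selected by their local factor, which is what later keeps the
  exchange operator local.\<close>

lemma restriction_map_eigenbasis:
  fixes M :: "('x::finite, 'd::finite) observable"
  assumes M: "hermitian_mat M"
  obtains C where "orthonormal C (\<lambda>c. c)" "C \<subseteq> local_vecs S"
    "onb (C \<times> confs (-S)) (\<lambda>p. tens S (fst p) (snd p))"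
    "\<And>c. c \<in> C \<Longrightarrow> \<exists>e. \<forall>\<eta>\<in>confs (-S). restriction_map S M *v tens S c \<eta> = e *s tens S c \<eta>"
proof -
  define B where "B \<alpha> \<beta> = partial_trace (-S) M \<alpha> \<beta> / CARD('d) ^ card (-S)" for \<alpha> \<beta>
  \<comment> \<open>The reduced operator on the region, padded with zeros so that it acts on vectors
    of the whole lattice and leaves \<open>local_vecs S\<close> invariant.\<close>
  define T where "T = (\<chi> \<alpha> \<beta>. if \<alpha> \<in> confs S \<and> \<beta> \<in> confs S then B \<alpha> \<beta> else 0)"
  have "hermitian_mat T"
    unfolding hermitian_mat_def T_def B_def
    by (auto intro: hermitian_partial_trace[OF M])
  moreover have "vec.subspace (local_vecs S :: (complex ^ ('x \<Rightarrow> 'd)) set)"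
    by (auto simp: vec.subspace_def local_vecs_def)
  moreover have "T *v v \<in> local_vecs S" for v
    by (auto simp: local_vecs_def T_def matrix_vector_mult_def)
  ultimately obtain C where C: "C \<subseteq> local_vecs S" "orthonormal C (\<lambda>c. c)"
    and eig: "\<And>c. c \<in> C \<Longrightarrow> \<exists>e. T *v c = e *s c"
    and complete: "\<And>v. v \<in> local_vecs S \<Longrightarrow> (\<Sum>c\<in>C. cin c v *s c) = v"
    by (rule spectral_theorem_subspace) blast
  have act: "restriction_map S M *v tens S u \<eta> = tens S (T *v u) \<eta>"
    if \<eta>: "\<eta> \<in> confs (-S)" for u \<eta>
  proof (rule vec_eq_glueI[of S])
    fix \<alpha> \<zeta> :: "'x \<Rightarrow> 'd"
    assume *: "\<alpha> \<in> confs S" "\<zeta> \<in> confs (-S)"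
    have "(restriction_map S M *v tens S u \<eta>) $ glue S \<alpha> \<zeta> = (\<Sum>\<beta>\<in>confs S. \<Sum>\<zeta>'\<in>confs (-S).
        if \<zeta>' = \<eta> then (if \<eta> = \<zeta> then B \<alpha> \<beta> * u $ \<beta> else 0) else 0)"
      unfolding matrix_vector_mult_def sum_glue[of _ S] vec_lambda_beta
      using * \<eta> by (intro sum.cong refl) (auto simp: restriction_map_glue tens_glue B_def)
    also have "\<dots> = (\<Sum>\<beta>\<in>confs S. if \<eta> = \<zeta> then T $ \<alpha> $ \<beta> * u $ \<beta> else 0)"
      using * \<eta> by (intro sum.cong refl) (simp add: T_def)
    also have "\<dots> = (\<Sum>\<beta>\<in>UNIV. if \<eta> = \<zeta> then T $ \<alpha> $ \<beta> * u $ \<beta> else 0)"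
      by (intro sum.mono_neutral_left) (auto simp: T_def)
    also have "\<dots> = tens S (T *v u) \<eta> $ glue S \<alpha> \<zeta>"
      using * \<eta> by (simp add: tens_glue matrix_vector_mult_def)
    finally show "(restriction_map S M *v tens S u \<eta>) $ glue S \<alpha> \<zeta> = tens S (T *v u) \<eta> $ glue S \<alpha> \<zeta>" .
  qed
  have "\<exists>e. \<forall>\<eta>\<in>confs (-S). restriction_map S M *v tens S c \<eta> = e *s tens S c \<eta>" if c: "c \<in> C" for c
  proof -
    obtain e where "T *v c = e *s c" using eig[OF c] by blast
    then have "\<forall>\<eta>\<in>confs (-S). restriction_map S M *v tens S c \<eta> = e *s tens S c \<eta>"
      by (simp add: act tens_smult)
    then show ?thesis ..
  qed
  then show ?thesis
    using that[OF C(2,1) onb_tens[OF C(2,1) complete]] by presburger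
qed

subsection \<open>Time averages\<close>

lemma has_time_average_add:
  assumes "has_time_average F m" "has_time_average G n" "continuous_on UNIV F" "continuous_on UNIV G"
  shows "has_time_average (\<lambda>t. F t + G t) (m + n)"
proof -
  have "(1 / T) * integral {0..T} (\<lambda>t. F t + G t)
      = (1 / T) * integral {0..T} F + (1 / T) * integral {0..T} G" for T
    using assms(3,4)
    by (subst integral_add) (auto intro!: integrable_continuous_real intro: continuous_on_subset simp: algebra_simps)
  then show ?thesis
    using tendsto_add[OF assms(1,2)[unfolded has_time_average_def]] by (simp add: has_time_average_def)
qed

lemma has_time_average_cmult:
  assumes "has_time_average F m"
  shows "has_time_average (\<lambda>t. c * F t) (c * m)"
  using tendsto_mult_left[OF assms[unfolded has_time_average_def], of c]
  by (simp add: has_time_average_def mult.left_commute)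

lemma has_time_average_const: "has_time_average (\<lambda>t. c) c"
proof -
  have "\<forall>\<^sub>F T in at_top. (1 / T) * integral {0..T} (\<lambda>t. c) = c"
    using eventually_gt_at_top[of "0 :: real"] by eventually_elim simp
  then show ?thesis unfolding has_time_average_def by (rule tendsto_eventually)
qed

lemma has_time_average_sum:
  assumes "\<And>j. j \<in> J \<Longrightarrow> has_time_average (F j) (m j)" "\<And>j. j \<in> J \<Longrightarrow> continuous_on UNIV (F j)"
  shows "has_time_average (\<lambda>t. \<Sum>j\<in>J. F j t) (\<Sum>j\<in>J. m j)"
  using assms
proof (induction J rule: infinite_finite_induct)
  case (insert j J)
  then show ?case
    by (simp del: split_paired_All) (intro has_time_average_add continuous_on_sum; simp)
qed (simp_all add: has_time_average_const)

text \<open>The integral up to \<open>T\<close> is \<open>G T - G 0\<close>, which stays bounded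
  while it is divided by \<open>T\<close>.\<close>

lemma has_time_average_bounded_antiderivative:
  assumes deriv: "\<And>t. (G has_real_derivative F t) (at t)" and bdd: "\<And>t. \<bar>G t\<bar> \<le> B"
  shows "has_time_average F 0"
  unfolding has_time_average_def
proof (rule Lim_null_comparison)
  show "\<forall>\<^sub>F T in at_top. norm ((1 / T) * integral {0..T} F) \<le> 2 * B * inverse T"
    using eventually_gt_at_top[of "0 :: real"]
  proof eventually_elim
    fix T :: real assume T: "T > 0"
    have "(F has_integral G T - G 0) {0..T}"
      using T deriv
      by (intro fundamental_theorem_of_calculus)
        (auto intro: has_field_derivative_at_within simp flip: has_real_derivative_iff_has_vector_derivative)
    then have "integral {0..T} F = G T - G 0" by (rule integral_unique)
    moreover have "\<bar>G T - G 0\<bar> \<le> 2 * B" using bdd[of T] bdd[of 0] by simp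
    ultimately show "norm ((1 / T) * integral {0..T} F) \<le> 2 * B * inverse T"
      using T by (simp add: field_simps abs_mult)
  qed
  show "((\<lambda>T. 2 * B * inverse T) \<longlongrightarrow> 0) at_top"
    by (intro tendsto_mult_right_zero tendsto_inverse_0_at_top filterlim_ident)
qed

lemma has_time_average_cos: "has_time_average (\<lambda>t. cos (w * t)) (if w = 0 then 1 else 0)"
proof (cases "w = 0")
  case False
  have "has_time_average (\<lambda>t. cos (w * t)) 0"
    by (rule has_time_average_bounded_antiderivative[where G = "\<lambda>t. sin (w * t) / w" and B = "1 / \<bar>w\<bar>"])
      (use False in \<open>auto intro!: derivative_eq_intros divide_right_mono simp: abs_divide\<close>)
  then show ?thesis using False by simp
qed (simp add: has_time_average_const)

lemma has_time_average_sin: "has_time_average (\<lambda>t. sin (w * t)) 0"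
proof (cases "w = 0")
  case False
  show ?thesis
    by (rule has_time_average_bounded_antiderivative[where G = "\<lambda>t. - cos (w * t) / w" and B = "1 / \<bar>w\<bar>"])
      (use False in \<open>auto intro!: derivative_eq_intros divide_right_mono simp: abs_divide\<close>)
qed (simp add: has_time_average_const)

lemma has_time_average_mono:
  assumes "has_time_average F m" "has_time_average G n" "continuous_on UNIV F" "continuous_on UNIV G"
    and le: "\<And>t. F t \<le> G t"
  shows "m \<le> n"
proof (rule tendsto_le[OF _ assms(2,1)[unfolded has_time_average_def]])
  show "\<forall>\<^sub>F T in at_top. (1 / T) * integral {0..T} F \<le> (1 / T) * integral {0..T} G"
    using eventually_gt_at_top[of "0 :: real"]
  proof eventually_elim
    fix T :: real assume "T > 0"
    then show "(1 / T) * integral {0..T} F \<le> (1 / T) * integral {0..T} G"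
      using assms(3,4) le
      by (intro mult_left_mono integral_le)
        (auto intro!: integrable_continuous_real intro: continuous_on_subset)
  qed
qed simp

text \<open>Uniformly close functions have uniformly close averages for every \<open>T > 0\<close>.
  The averages of the approximants converge, so those of \<open>F\<close> are eventually within any
  prescribed distance of each other, and completeness of the reals supplies the limit.\<close>

lemma has_time_average_uniform_limit:
  assumes cont: "continuous_on UNIV F"
    and approx: "\<And>e. e > 0 \<Longrightarrow> \<exists>G m. continuous_on UNIV G \<and> has_time_average G m \<and> (\<forall>t. \<bar>F t - G t\<bar> \<le> e)"
  shows "\<exists>m. has_time_average F m"
proof -
  define av where "av F T = (1 / T) * integral {0..T} F" for F :: "real \<Rightarrow> real" and T
  have close: "\<bar>av F T - av G T\<bar> \<le> e"
    if "continuous_on UNIV G" "\<forall>t. \<bar>F t - G t\<bar> \<le> e" "T > 0" for G e T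
  proof -
    have int: "F integrable_on {0..T}" "G integrable_on {0..T}"
      using cont that(1) by (auto intro!: integrable_continuous_real intro: continuous_on_subset)
    have "\<bar>integral {0..T} (\<lambda>t. F t - G t)\<bar> \<le> integral {0..T} (\<lambda>t. e)"
      using that int integral_norm_bound_integral[of "\<lambda>t. F t - G t" "{0..T}" "\<lambda>t. e"]
      by (auto intro: integrable_diff)
    then show ?thesis
      using \<open>T > 0\<close> int by (simp add: av_def integral_diff field_simps flip: right_diff_distrib abs_mult)
  qed
  have "\<exists>G m. continuous_on UNIV G \<and> has_time_average G m \<and> (\<forall>t. \<bar>F t - G t\<bar> \<le> inverse (real (Suc n)))" for n
    by (rule approx) simp
  then obtain G m where G: "\<And>n. continuous_on UNIV (G n)" "\<And>n. has_time_average (G n) (m n)"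
    "\<And>n t. \<bar>F t - G n t\<bar> \<le> inverse (real (Suc n))"
    by metis
  have ev: "\<forall>\<^sub>F T in at_top. \<bar>av F T - m n\<bar> < 2 * inverse (real (Suc n))" for n
  proof -
    have "\<forall>\<^sub>F T in at_top. \<bar>av (G n) T - m n\<bar> < inverse (real (Suc n))"
      using tendstoD[OF G(2)[unfolded has_time_average_def], of "inverse (real (Suc n))" n]
      by (simp add: av_def dist_real_def)
    then show ?thesis using eventually_gt_at_top[of "0 :: real"]
    proof eventually_elim
      fix T :: real
      assume "\<bar>av (G n) T - m n\<bar> < inverse (real (Suc n))" "T > 0"
      then show "\<bar>av F T - m n\<bar> < 2 * inverse (real (Suc n))"
        using close[OF G(1) allI[OF G(3)], of T n] by linarith
    qed
  qed
  have "cauchy_filter (filtermap (av F) at_top)"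
    unfolding cauchy_filter_metric_filtermap
  proof (intro allI impI)
    fix e :: real assume "e > 0"
    then obtain n where n: "inverse (real (Suc n)) < e / 4"
      using reals_Archimedean[of "e / 4"] by auto
    show "\<exists>P. eventually P at_top \<and> (\<forall>x y. P x \<and> P y \<longrightarrow> dist (av F x) (av F y) < e)"
      by (rule exI[of _ "\<lambda>T. \<bar>av F T - m n\<bar> < 2 * inverse (real (Suc n))"])
        (use ev n in \<open>auto simp: dist_real_def\<close>)
  qed
  moreover have nbot: "filtermap (av F) at_top \<noteq> bot" by (simp add: filtermap_bot_iff)
  moreover have "complete (UNIV :: real set)" by (simp add: complete_UNIV)
  ultimately obtain x where "filtermap (av F) at_top \<le> nhds x"
    unfolding complete_uniform using nbot by auto
  then show ?thesis
    unfolding has_time_average_def filterlim_def av_def by blast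
qed

subsection \<open>Trigonometric polynomials\<close>

text \<open>Frequencies are arbitrary reals. Constants arise with \<open>w = 0\<close>, and the
  product-to-sum formulas close the class under multiplication.\<close>

inductive trig_poly :: "(real \<Rightarrow> real) \<Rightarrow> bool" where
  cos: "trig_poly (\<lambda>t. c * cos (w * t))"
| sin: "trig_poly (\<lambda>t. c * sin (w * t))"
| add: "trig_poly f \<Longrightarrow> trig_poly g \<Longrightarrow> trig_poly (\<lambda>t. f t + g t)"

lemma trig_poly_const: "trig_poly (\<lambda>t. c)"
  using trig_poly.cos[of c 0] by simp

lemma trig_poly_sum: "(\<And>j. j \<in> J \<Longrightarrow> trig_poly (f j)) \<Longrightarrow> trig_poly (\<lambda>t. \<Sum>j\<in>J. f j t)"
  by (induction J rule: infinite_finite_induct) (simp_all add: trig_poly_const trig_poly.add)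

lemma trig_poly_cos_mult: "trig_poly g \<Longrightarrow> trig_poly (\<lambda>t. c * cos (w * t) * g t)"
proof (induction rule: trig_poly.induct)
  case (cos d v)
  have "(\<lambda>t. c * cos (w * t) * (d * cos (v * t)))
      = (\<lambda>t. (c * d / 2) * cos ((w - v) * t) + (c * d / 2) * cos ((w + v) * t))"
    by (simp add: fun_eq_iff cos_diff cos_add algebra_simps)
  then show ?case by (simp only: trig_poly.intros)
next
  case (sin d v)
  have "(\<lambda>t. c * cos (w * t) * (d * sin (v * t)))
      = (\<lambda>t. (c * d / 2) * sin ((w + v) * t) + (- c * d / 2) * sin ((w - v) * t))"
    by (simp add: fun_eq_iff sin_diff sin_add algebra_simps)
  then show ?case by (simp only: trig_poly.intros)
qed (simp add: distrib_left trig_poly.add)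

lemma trig_poly_sin_mult: "trig_poly g \<Longrightarrow> trig_poly (\<lambda>t. c * sin (w * t) * g t)"
proof (induction rule: trig_poly.induct)
  case (cos d v)
  have "(\<lambda>t. c * sin (w * t) * (d * cos (v * t)))
      = (\<lambda>t. (c * d / 2) * sin ((w + v) * t) + (c * d / 2) * sin ((w - v) * t))"
    by (simp add: fun_eq_iff sin_diff sin_add algebra_simps)
  then show ?case by (simp only: trig_poly.intros)
next
  case (sin d v)
  have "(\<lambda>t. c * sin (w * t) * (d * sin (v * t)))
      = (\<lambda>t. (c * d / 2) * cos ((w - v) * t) + (- c * d / 2) * cos ((w + v) * t))"
    by (simp add: fun_eq_iff cos_diff cos_add algebra_simps)
  then show ?case by (simp only: trig_poly.intros)
qed (simp add: distrib_left trig_poly.add)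

lemma trig_poly_mult: "trig_poly f \<Longrightarrow> trig_poly g \<Longrightarrow> trig_poly (\<lambda>t. f t * g t)"
  by (induction rule: trig_poly.induct)
    (simp_all add: trig_poly_cos_mult trig_poly_sin_mult distrib_right trig_poly.add)

lemma trig_poly_continuous: "trig_poly f \<Longrightarrow> continuous_on UNIV f"
  by (induction rule: trig_poly.induct) (auto intro!: continuous_intros)

lemma trig_poly_has_time_average: "trig_poly f \<Longrightarrow> \<exists>m. has_time_average f m"
  by (induction rule: trig_poly.induct)
    (blast intro: has_time_average_cmult[OF has_time_average_cos] has_time_average_cmult[OF has_time_average_sin]
      has_time_average_add trig_poly_continuous)+

section \<open>Matrix-valued quasiperiodic functions\<close>

definition quasiperiodic :: "'j set \<Rightarrow> ('j \<Rightarrow> real) \<Rightarrow> ('j \<Rightarrow> complex ^ 'a::finite ^ 'a) \<Rightarrow> real \<Rightarrow> complex ^ 'a ^ 'a" where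
  "quasiperiodic J w M t = (\<Sum>j\<in>J. scale_mat (cis (t * w j)) (M j))"

lemma continuous_on_scale_mat [continuous_intros]:
  "continuous_on T f \<Longrightarrow> continuous_on T (\<lambda>t. scale_mat (f t) (M :: complex ^ 'a::finite ^ 'a))"
  by (rule bounded_linear.continuous_on[OF bounded_linear_scale_mat])

lemma continuous_on_quasiperiodic: "continuous_on UNIV (quasiperiodic J w M)"
  unfolding quasiperiodic_def by (intro continuous_intros)

text \<open>A real-linear functional of the orbit is a trigonometric polynomial, since each phase
  splits into a cosine and a sine; sums and products then stay in the class.\<close>

lemma trig_poly_polynomial:
  fixes M :: "'j \<Rightarrow> complex ^ 'a::finite ^ 'a"
  assumes "real_polynomial_function p"
  shows "trig_poly (\<lambda>t. p (quasiperiodic J w M t))"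
  using assms
proof (induction rule: real_polynomial_function.induct)
  case (linear f)
  have cis: "scale_mat (cis s) N = cos s *\<^sub>R N + sin s *\<^sub>R scale_mat \<i> N" for s and N :: "complex ^ 'a ^ 'a"
    by (simp add: vec_eq_iff scale_mat_def complex_eq_iff)
  interpret f: bounded_linear f by fact
  have "(\<lambda>t. f (quasiperiodic J w M t))
      = (\<lambda>t. \<Sum>j\<in>J. f (M j) * cos (w j * t) + f (scale_mat \<i> (M j)) * sin (w j * t))"
    by (simp add: quasiperiodic_def f.sum cis f.add f.scaleR mult.commute)
  then show ?case
    by (simp only:) (intro trig_poly_sum trig_poly.intros)
qed (simp_all add: trig_poly_const trig_poly.add trig_poly_mult)

lemma quasiperiodic_has_time_average:
  assumes \<Phi>: "continuous_on UNIV (\<Phi> :: complex ^ 'a::finite ^ 'a \<Rightarrow> real)"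
  shows "\<exists>m. has_time_average (\<lambda>t. \<Phi> (quasiperiodic J w M t)) m"
proof (rule has_time_average_uniform_limit)
  show "continuous_on UNIV (\<lambda>t. \<Phi> (quasiperiodic J w M t))"
    by (intro continuous_on_compose2[OF \<Phi> continuous_on_quasiperiodic]) auto
next
  fix e :: real assume e: "e > 0"
  \<comment> \<open>Phases have modulus one, so the whole orbit stays in one compact ball.
    Approximating \<Phi> uniformly there approximates the function of time uniformly for all
    times.\<close>
  have bdd: "quasiperiodic J w M t \<in> cball 0 (\<Sum>j\<in>J. norm (M j))" for t
    unfolding quasiperiodic_def mem_cball dist_0_norm
    by (rule sum_norm_le) (simp add: norm_scale_mat)
  obtain p where p: "real_polynomial_function p"
    "\<And>x. x \<in> cball 0 (\<Sum>j\<in>J. norm (M j)) \<Longrightarrow> \<bar>\<Phi> x - p x\<bar> < e"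
    using Stone_Weierstrass_real_polynomial_function[OF compact_cball continuous_on_subset[OF \<Phi>] e]
    by (metis subset_UNIV)
  have "trig_poly (\<lambda>t. p (quasiperiodic J w M t))"
    by (rule trig_poly_polynomial[OF p(1)])
  then show "\<exists>G m. continuous_on UNIV G \<and> has_time_average G m \<and> (\<forall>t. \<bar>\<Phi> (quasiperiodic J w M t) - G t\<bar> \<le> e)"
    using trig_poly_continuous trig_poly_has_time_average less_imp_le[OF p(2)[OF bdd]] by metis
qed

text \<open>The cross term of \<open>j\<close> and \<open>k\<close> oscillates with frequency
  \<open>w k - w j\<close>, which is nonzero unless \<open>j = k\<close>; only the diagonal terms
  survive averaging.\<close>

lemma quasiperiodic_norm_sq_has_time_average:
  assumes inj: "inj_on w J"
  shows "has_time_average (\<lambda>t. (norm (quasiperiodic J w M t))\<^sup>2) (\<Sum>j\<in>J. (norm (M j))\<^sup>2)"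
proof (cases "finite J")
  case True
  define F where "F j k t = Re (hs (M j) (M k)) * cos ((w k - w j) * t)
      + (- Im (hs (M j) (M k))) * sin ((w k - w j) * t)" for j k t
  have "scale_mat (cis (t * w j)) (M j) \<bullet> scale_mat (cis (t * w k)) (M k) = F j k t" for j k t
  proof -
    have "hs (scale_mat (cis (t * w j)) (M j)) (scale_mat (cis (t * w k)) (M k))
        = cis ((w k - w j) * t) * hs (M j) (M k)"
    proof -
      have "cnj (cis (t * w j)) * cis (t * w k) = cis ((w k - w j) * t)"
        unfolding cis_cnj cis_mult by (simp add: algebra_simps)
      then show ?thesis by (simp add: hs_scale_left hs_scale_right flip: mult.assoc) (metis mult.commute)
    qed
    then show ?thesis by (simp flip: Re_hs add: F_def mult.commute)
  qed
  then have norm_eq: "(norm (quasiperiodic J w M t))\<^sup>2 = (\<Sum>j\<in>J. \<Sum>k\<in>J. F j k t)" for t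
    by (simp add: power2_norm_eq_inner quasiperiodic_def inner_sum_left inner_sum_right)
      (rule sum.swap)
  have cont: "continuous_on UNIV (F j k)" for j k
    unfolding F_def by (intro continuous_intros)
  have F: "has_time_average (F j k) (if j = k then (norm (M j))\<^sup>2 else 0)" if "j \<in> J" "k \<in> J" for j k
  proof -
    have "has_time_average (F j k) (Re (hs (M j) (M k)) * (if w k - w j = 0 then 1 else 0)
        + (- Im (hs (M j) (M k))) * 0)"
      unfolding F_def
      by (intro has_time_average_add has_time_average_cmult has_time_average_cos has_time_average_sin
          continuous_intros)
    moreover have "w k - w j = 0 \<longleftrightarrow> j = k" using inj that by (auto simp: inj_on_def)
    ultimately show ?thesis by (auto simp: Re_hs power2_norm_eq_inner)
  qed
  have "has_time_average (\<lambda>t. \<Sum>j\<in>J. \<Sum>k\<in>J. F j k t) (\<Sum>j\<in>J. \<Sum>k\<in>J. if j = k then (norm (M j))\<^sup>2 else 0)"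
    by (intro has_time_average_sum F continuous_on_sum cont)
  then show ?thesis using True by (simp add: norm_eq)
\<comment> \<open>For infinite \<open>J\<close> both sums are 0 by convention.\<close>
qed (simp add: quasiperiodic_def has_time_average_const)

subsection \<open>Projections onto part of an orthonormal family\<close>

definition proj :: "('l \<Rightarrow> complex ^ 'a::finite) \<Rightarrow> 'l set \<Rightarrow> complex ^ 'a ^ 'a" where
  "proj a T = (\<Sum>l\<in>T. outer (a l) (a l))"

lemma proj_mult_vec: "proj a T *v v = (\<Sum>l\<in>T. cin (a l) v *s a l)"
  by (simp add: proj_def sum_mult_vec outer_mult_vec)

lemma cin_proj:
  assumes "orthonormal L a" "T \<subseteq> L" "l \<in> L"
  shows "cin (a l) (proj a T *v v) = (if l \<in> T then cin (a l) v else 0)"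
proof -
  have "cin (a l) (proj a T *v v) = (\<Sum>m\<in>T. if l = m then cin (a l) v else 0)"
    unfolding proj_mult_vec cin_sum_right cin_scale_right
    using assms(2) by (intro sum.cong refl) (auto simp: orthonormalD[OF assms(1,3)])
  then show ?thesis
    using finite_subset[OF assms(2) orthonormal_finite[OF assms(1)]] by simp
qed

lemma norm_proj_disjoint:
  assumes onb: "onb L a" and T: "T1 \<subseteq> L" "T2 \<subseteq> L" "T1 \<inter> T2 = {}"
  shows "(norm (proj a T1 *v v))\<^sup>2 + (norm (proj a T2 *v v))\<^sup>2 \<le> (norm v)\<^sup>2"
  unfolding onb_norm[OF onb] sum.distrib[symmetric]
  using T by (intro sum_mono) (auto simp: cin_proj[OF onb_orthonormal[OF onb]])

lemma norm_proj_le_compl: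
  assumes onb: "onb L a" and T: "T1 \<subseteq> L" "T2 \<subseteq> L" "T1 \<inter> T2 = {}"
  shows "norm (proj a T2 *v v) \<le> norm (v - proj a T1 *v v)"
proof -
  have "(norm (proj a T2 *v v))\<^sup>2 \<le> (norm (v - proj a T1 *v v))\<^sup>2"
    unfolding onb_norm[OF onb]
    using T by (intro sum_mono) (auto simp: cin_proj[OF onb_orthonormal[OF onb]] cin_diff_right)
  then show ?thesis by (simp add: power2_le_iff_abs_le)
qed

subsection \<open>Perturbed eigenvectors\<close>

text \<open>An estimate of Davis-Kahan type. The vector
  \<open>Z *v x - \<mu> *s x = (Z - Z') *v x\<close> has norm at most \<open>g\<close>, and its
  coefficient on \<open>a l\<close> is that of \<open>x\<close> times
  \<open>\<zeta> l - \<mu>\<close>. This factor has modulus at least \<open>\<gamma> - g\<close>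
  whenever \<open>\<zeta> l \<noteq> z\<close>.\<close>

lemma norm_compl_proj_le:
  assumes onb: "onb L a" and eig: "\<And>l. l \<in> L \<Longrightarrow> Z *v a l = \<zeta> l *s a l"
    and gap: "\<And>l. l \<in> L \<Longrightarrow> \<zeta> l \<noteq> z \<Longrightarrow> \<gamma> \<le> cmod (\<zeta> l - z)"
    and Z': "Z' *v x = \<mu> *s x" "norm x = 1" "cmod (\<mu> - z) \<le> g" "opnorm (Z - Z') \<le> g" and g: "g < \<gamma>"
  shows "norm (x - proj a {l \<in> L. \<zeta> l = z} *v x) \<le> g / (\<gamma> - g)"
proof -
  let ?T = "{l \<in> L. \<zeta> l = z}"
  have "((\<gamma> - g) * norm (x - proj a ?T *v x))\<^sup>2
      = (\<Sum>l\<in>L. (\<gamma> - g)\<^sup>2 * (cmod (cin (a l) (x - proj a ?T *v x)))\<^sup>2)"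
    by (simp add: power_mult_distrib onb_norm[OF onb] sum_distrib_left)
  also have "\<dots> \<le> (\<Sum>l\<in>L. (cmod (cin (a l) (Z *v x - \<mu> *s x)))\<^sup>2)"
  proof (rule sum_mono)
    fix l assume l: "l \<in> L"
    have eq: "cin (a l) (Z *v x - \<mu> *s x) = (\<zeta> l - \<mu>) * cin (a l) x"
      by (simp add: cin_diff_right cin_scale_right cin_diagonal[OF onb eig l] algebra_simps)
    show "(\<gamma> - g)\<^sup>2 * (cmod (cin (a l) (x - proj a ?T *v x)))\<^sup>2 \<le> (cmod (cin (a l) (Z *v x - \<mu> *s x)))\<^sup>2"
    proof (cases "\<zeta> l = z")
      case False
      have "cmod (\<zeta> l - z) \<le> cmod (\<zeta> l - \<mu>) + cmod (\<mu> - z)"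
        by (metis diff_add_cancel add_diff_eq norm_triangle_ineq)
      then have "\<gamma> - g \<le> cmod (\<zeta> l - \<mu>)"
        using gap[OF l False] Z'(3) by simp
      then have "(\<gamma> - g)\<^sup>2 \<le> (cmod (\<zeta> l - \<mu>))\<^sup>2" using g by (intro power_mono) auto
      then show ?thesis
        using l False unfolding eq
        by (simp add: cin_diff_right cin_proj[OF onb_orthonormal[OF onb]] norm_mult power_mult_distrib
            mult_right_mono)
    qed (use l in \<open>simp add: cin_diff_right cin_proj[OF onb_orthonormal[OF onb]]\<close>)
  qed
  also have "\<dots> = (norm ((Z - Z') *v x))\<^sup>2"
    by (simp add: Z'(1) matrix_vector_mult_diff_rdistrib flip: onb_norm[OF onb])
  also have "\<dots> \<le> g\<^sup>2"
    using opnorm_bound[of "Z - Z'" x] Z'(2,4) by (intro power_mono) auto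
  finally have "(\<gamma> - g) * norm (x - proj a ?T *v x) \<le> g"
    using g order_trans[OF opnorm_nonneg Z'(4)] by (simp add: power2_le_iff_abs_le abs_mult)
  then show ?thesis using g by (simp add: field_simps)
qed

text \<open>Projecting onto the nearby eigenvectors of \<open>Z'\<close> is injective on the
  eigenspace of \<open>Z\<close>: a nonzero \<open>v\<close> in the kernel would give
  \<open>Z' *v v - z *s v\<close> a norm above \<open>g * norm v\<close>, while on the eigenspace
  this vector is \<open>(Z' - Z) *v v\<close>.\<close>

lemma dim_eigenspace_le:
  fixes Z Z' :: "complex ^ 'a::finite ^ 'a"
  assumes onb: "onb L q" and eig: "\<And>p. p \<in> L \<Longrightarrow> Z' *v q p = \<mu> p *s q p" and close: "opnorm (Z - Z') \<le> g"
  shows "vec.dim (eigenspace Z z) \<le> card {p \<in> L. cmod (\<mu> p - z) \<le> g}"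
proof -
  let ?D = "{p \<in> L. cmod (\<mu> p - z) \<le> g}"
  let ?f = "\<lambda>v. proj q ?D *v v"
  note on = onb_orthonormal[OF onb]
  have fin: "finite L" by (rule orthonormal_finite[OF on])
  have g0: "0 \<le> g" using opnorm_nonneg close by (rule order_trans)
  have sub: "vec.subspace (eigenspace Z z)"
    by (auto simp: vec.subspace_def eigenspace_def matrix_vector_right_distrib matvec_smult
        vec.scale_right_distrib mult.commute)
  have zero: "v = 0" if v: "v \<in> eigenspace Z z" and f0: "?f v = 0" for v
  proof -
    have vD: "cin (q p) v = 0" if "p \<in> ?D" for p
      using cin_proj[OF on, of ?D p v] that f0 by auto
    have "(\<Sum>p\<in>L. (cmod (\<mu> p - z))\<^sup>2 * (cmod (cin (q p) v))\<^sup>2) = (\<Sum>p\<in>L. (cmod (cin (q p) (Z' *v v - z *s v)))\<^sup>2)"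
      by (intro sum.cong refl) (simp add: cin_diff_right cin_scale_right cin_diagonal[OF onb eig]
          flip: left_diff_distrib power_mult_distrib norm_mult)
    also have "\<dots> = (norm ((Z - Z') *v v))\<^sup>2"
      using v by (simp add: eigenspace_def matrix_vector_mult_diff_rdistrib norm_minus_commute flip: onb_norm[OF onb])
    also have "\<dots> \<le> (g * norm v)\<^sup>2"
      using opnorm_bound[of "Z - Z'" v] close
      by (intro power_mono) (auto intro: order_trans[OF _ mult_right_mono])
    also have "\<dots> = (\<Sum>p\<in>L. g\<^sup>2 * (cmod (cin (q p) v))\<^sup>2)"
      by (simp add: power_mult_distrib onb_norm[OF onb] sum_distrib_left)
    \<comment> \<open>Coefficients with index in \<open>?D\<close> vanish and all others carry a
      strictly positive weight, so this nonpositive sum forces every coefficient to be 0.\<close>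
    finally have le: "(\<Sum>p\<in>L. ((cmod (\<mu> p - z))\<^sup>2 - g\<^sup>2) * (cmod (cin (q p) v))\<^sup>2) \<le> 0"
      by (simp add: sum_subtractf left_diff_distrib)
    have pos: "g\<^sup>2 < (cmod (\<mu> p - z))\<^sup>2" if "p \<in> L" "p \<notin> ?D" for p
      using that g0 by (intro power_strict_mono) auto
    have nonneg: "0 \<le> ((cmod (\<mu> p - z))\<^sup>2 - g\<^sup>2) * (cmod (cin (q p) v))\<^sup>2" if "p \<in> L" for p
      using that pos[of p] vD[of p] by (cases "p \<in> ?D") auto
    have "(\<Sum>p\<in>L. ((cmod (\<mu> p - z))\<^sup>2 - g\<^sup>2) * (cmod (cin (q p) v))\<^sup>2) = 0"
      by (rule antisym[OF le sum_nonneg]) (rule nonneg)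
    then have all0: "\<forall>p\<in>L. ((cmod (\<mu> p - z))\<^sup>2 - g\<^sup>2) * (cmod (cin (q p) v))\<^sup>2 = 0"
      by (subst (asm) sum_nonneg_eq_0_iff[OF fin]) (auto intro: nonneg)
    have "cin (q p) v = cin (q p) 0" if "p \<in> L" for p
      using all0[rule_format, OF that] pos[OF that] vD[of p] by (cases "p \<in> ?D") auto
    then show "v = 0" by (rule onb_eqI[OF onb])
  qed
  have "inj_on ?f (vec.span (eigenspace Z z))"
  proof (rule inj_onI)
    fix u v assume "u \<in> vec.span (eigenspace Z z)" "v \<in> vec.span (eigenspace Z z)" and eq: "?f u = ?f v"
    then have "u - v \<in> eigenspace Z z"
      using sub by (simp add: vec.span_eq_iff[THEN iffD2] vec.subspace_diff)
    then show "u = v" using zero[of "u - v"] eq by (simp add: matrix_vector_mult_diff_distrib)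
  qed
  then have "vec.dim (eigenspace Z z) = vec.dim (?f ` eigenspace Z z)"
    by (intro vec.dim_image_eq[symmetric] matrix_vector_mul_linear_gen)
  also have "\<dots> \<le> card (q ` ?D)"
  proof (rule vec.dim_le_card)
    show "?f ` eigenspace Z z \<subseteq> vec.span (q ` ?D)"
      unfolding proj_mult_vec
      by (rule image_subsetI) (intro vec.span_sum vec.span_scale vec.span_base imageI)
  qed (use fin in auto)
  also have "\<dots> \<le> card ?D" using fin by (intro card_image_le) auto
  finally show ?thesis .
qed

subsection \<open>Partial isometries\<close>

definition partial_isometry :: "'i set \<Rightarrow> ('i \<Rightarrow> complex ^ 'a::finite) \<Rightarrow> ('i \<Rightarrow> complex ^ 'a) \<Rightarrow> complex ^ 'a ^ 'a" where
  "partial_isometry I x y = (\<Sum>i\<in>I. outer (x i) (y i))"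

lemma partial_isometry_mult_vec: "partial_isometry I x y *v v = (\<Sum>i\<in>I. cin (y i) v *s x i)"
  by (simp add: partial_isometry_def sum_mult_vec outer_mult_vec)

lemma cin_partial_isometry:
  assumes "orthonormal I x" "i \<in> I"
  shows "cin (x i) (partial_isometry I x y *v v) = cin (y i) v"
  unfolding partial_isometry_mult_vec by (rule cin_orthonormal_sum[OF assms])

lemma partial_isometry_mult_basis:
  assumes "orthonormal I y" "i \<in> I"
  shows "partial_isometry I x y *v y i = x i"
proof -
  have "partial_isometry I x y *v y i = (\<Sum>j\<in>I. if j = i then x i else 0)"
    unfolding partial_isometry_mult_vec
    by (intro sum.cong refl) (auto simp: orthonormalD[OF assms(1) _ assms(2)])
  then show ?thesis using assms orthonormal_finite by fastforce
qed

lemma norm_partial_isometry_le: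
  assumes "orthonormal I x" "orthonormal I y"
  shows "norm (partial_isometry I x y *v v) \<le> norm v"
proof -
  have "(norm (partial_isometry I x y *v v))\<^sup>2 \<le> (norm v)\<^sup>2"
    unfolding partial_isometry_mult_vec norm_orthonormal_sum[OF assms(1)] by (rule bessel[OF assms(2)])
  then show ?thesis by (simp add: power2_le_iff_abs_le)
qed

lemma opnorm_partial_isometry:
  assumes "orthonormal I x" "orthonormal I y" "I \<noteq> {}"
  shows "opnorm (partial_isometry I x y) = 1"
proof (rule antisym)
  show "opnorm (partial_isometry I x y) \<le> 1"
    by (rule opnorm_leI) (simp add: norm_partial_isometry_le[OF assms(1,2)])
  obtain i where i: "i \<in> I" using assms(3) by blast
  show "1 \<le> opnorm (partial_isometry I x y)"
    using opnorm_bound[of "partial_isometry I x y" "y i"]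
    by (simp add: partial_isometry_mult_basis[OF assms(2) i] orthonormal_norm[OF assms(1) i]
        orthonormal_norm[OF assms(2) i])
qed

lemma inner_partial_isometry: "partial_isometry I x y \<bullet> M = (\<Sum>i\<in>I. Re (cin (x i) (M *v y i)))"
  by (simp add: partial_isometry_def inner_sum_left inner_outer)

lemma norm_partial_isometry:
  assumes "orthonormal I x" "orthonormal I y"
  shows "(norm (partial_isometry I x y))\<^sup>2 = card I"
  unfolding power2_norm_eq_inner inner_partial_isometry
  by (simp add: cin_partial_isometry[OF assms(1)] orthonormalD[OF assms(2)])

lemma orthonormal_compose:
  assumes "orthonormal L a" "inj_on f I" "f ` I \<subseteq> L" "finite I"
  shows "orthonormal I (\<lambda>i. a (f i))"
  using assms by (auto simp: orthonormal_def inj_on_def image_subset_iff)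

text \<open>The part of the partial isometry that maps between the ranges of two projections, normalised
  so that it has trace norm at most one.\<close>

definition off_diagonal ::
    "('l \<Rightarrow> complex ^ 'a::finite) \<Rightarrow> 'l set \<Rightarrow> 'l set \<Rightarrow> 'i set \<Rightarrow> ('i \<Rightarrow> complex ^ 'a) \<Rightarrow> ('i \<Rightarrow> complex ^ 'a) \<Rightarrow> complex ^ 'a ^ 'a" where
  "off_diagonal a T1 T2 I x y = (1 / card I) *\<^sub>R (\<Sum>i\<in>I.
     outer (proj a T1 *v x i) (proj a T2 *v y i) + outer (proj a T2 *v x i) (proj a T1 *v y i))"

lemma inner_off_diagonal:
  "off_diagonal a T1 T2 I x y \<bullet> M = (\<Sum>i\<in>I.
     Re (cin (proj a T1 *v x i) (M *v (proj a T2 *v y i))) +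
     Re (cin (proj a T2 *v x i) (M *v (proj a T1 *v y i)))) / card I"
  by (simp add: off_diagonal_def inner_sum_left inner_add_left inner_outer)

locale two_projections =
  fixes L :: "'l set" and a :: "'l \<Rightarrow> complex ^ 'a::finite" and T1 T2 :: "'l set"
    and I :: "'i set" and x y :: "'i \<Rightarrow> complex ^ 'a"
  assumes onb: "onb L a" and T: "T1 \<subseteq> L" "T2 \<subseteq> L" "T1 \<inter> T2 = {}"
    and x: "orthonormal I x" and y: "orthonormal I y" and I: "I \<noteq> {}"
begin

abbreviation "K \<equiv> off_diagonal a T1 T2 I x y"
abbreviation "A \<equiv> partial_isometry I x y"

lemma card_I: "card I > 0"
  using I orthonormal_finite[OF x] by (simp add: card_gt_0_iff)

text \<open>By duality between trace norm and operator norm, this expresses that \<open>K\<close>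
  has trace norm at most one. It holds for each index separately, since
  \<open>p * r + q * s \<le> 1\<close> when \<open>(p, q)\<close> and \<open>(r, s)\<close> lie in
  the unit disc.\<close>

lemma inner_off_diagonal_le: "K \<bullet> M \<le> opnorm M"
proof -
  have "Re (cin (proj a T1 *v x i) (M *v (proj a T2 *v y i))) +
     Re (cin (proj a T2 *v x i) (M *v (proj a T1 *v y i))) \<le> opnorm M" if i: "i \<in> I" for i
  proof -
    define p q r s where "p = norm (proj a T1 *v x i)" "q = norm (proj a T2 *v x i)"
      "r = norm (proj a T2 *v y i)" "s = norm (proj a T1 *v y i)"
    have Re: "Re (cin u (M *v v)) \<le> opnorm M * (norm u * norm v)" for u v
    proof -
      have "Re (cin u (M *v v)) \<le> norm u * norm (M *v v)"
        using complex_Re_le_cmod cmod_cin_le by (rule order_trans)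
      also have "\<dots> \<le> norm u * (opnorm M * norm v)"
        by (intro mult_left_mono opnorm_bound) auto
      finally show ?thesis by (simp add: mult_ac)
    qed
    have "p\<^sup>2 + q\<^sup>2 \<le> 1" "s\<^sup>2 + r\<^sup>2 \<le> 1"
      using norm_proj_disjoint[OF onb T, of "x i"] norm_proj_disjoint[OF onb T, of "y i"]
      by (simp_all add: p_q_r_s_def orthonormal_norm[OF x i] orthonormal_norm[OF y i])
    moreover have "2 * (p * r) \<le> p\<^sup>2 + r\<^sup>2" "2 * (q * s) \<le> q\<^sup>2 + s\<^sup>2"
      using sum_squares_bound[of p r] sum_squares_bound[of q s] by simp_all
    ultimately have "p * r + q * s \<le> 1" by linarith
    then have "opnorm M * (p * r) + opnorm M * (q * s) \<le> opnorm M"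
      using mult_left_mono[of "p * r + q * s" 1 "opnorm M"] opnorm_nonneg[of M]
      by (simp add: distrib_left)
    then show ?thesis
      using Re[of "proj a T1 *v x i" "proj a T2 *v y i"] Re[of "proj a T2 *v x i" "proj a T1 *v y i"]
      unfolding p_q_r_s_def by linarith
  qed
  then have "(\<Sum>i\<in>I. Re (cin (proj a T1 *v x i) (M *v (proj a T2 *v y i))) +
     Re (cin (proj a T2 *v x i) (M *v (proj a T1 *v y i)))) \<le> (\<Sum>i\<in>I. opnorm M)"
    by (rule sum_mono)
  then show ?thesis using card_I
    by (simp add: inner_off_diagonal divide_le_eq mult.commute)
qed

lemma coef_off_diagonal:
  assumes l: "l \<in> L" and m: "m \<in> L"
  shows "cin (a l) (K *v a m)
    = (if l \<in> T1 \<and> m \<in> T2 \<or> l \<in> T2 \<and> m \<in> T1 then cin (a l) (A *v a m) else 0) / card I"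
proof -
  note on = onb_orthonormal[OF onb]
  have swap: "cin (proj a T *v v) (a m) = (if m \<in> T then cin v (a m) else 0)" if "T \<subseteq> L" for T v
    using arg_cong[OF cin_proj[OF on that m, of v], where f = cnj] by (simp add: cin_cnj if_distrib cong: if_cong)
  have K: "K = scale_mat (1 / card I) (\<Sum>i\<in>I.
     outer (proj a T1 *v x i) (proj a T2 *v y i) + outer (proj a T2 *v x i) (proj a T1 *v y i))"
    unfolding off_diagonal_def scale_mat_of_real[symmetric] by simp
  have "cin (a l) (K *v a m) = (\<Sum>i\<in>I.
      cin (proj a T2 *v y i) (a m) * cin (a l) (proj a T1 *v x i) +
      cin (proj a T1 *v y i) (a m) * cin (a l) (proj a T2 *v x i)) / card I"
    unfolding K
    by (simp add: scale_mat_mult_vec sum_mult_vec matrix_vector_mult_add_rdistrib outer_mult_vec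
        cin_scale_right cin_sum_right cin_add_right)
  also have "\<dots> = (\<Sum>i\<in>I. if l \<in> T1 \<and> m \<in> T2 \<or> l \<in> T2 \<and> m \<in> T1
      then cin (y i) (a m) * cin (a l) (x i) else 0) / card I"
    using T l m by (intro arg_cong2[of _ _ _ _ "(/)"] sum.cong refl) (auto simp: swap cin_proj[OF on])
  also have "\<dots> = (if l \<in> T1 \<and> m \<in> T2 \<or> l \<in> T2 \<and> m \<in> T1 then cin (a l) (A *v a m) else 0) / card I"
    by (auto simp: partial_isometry_mult_vec cin_sum_right cin_scale_right)
  finally show ?thesis .
qed

lemma coef_off_diagonal_diag: "l \<in> L \<Longrightarrow> cin (a l) (K *v a l) = 0"
  using T by (auto simp: coef_off_diagonal)

text \<open>In the basis \<open>a\<close>, passing from \<open>A\<close> to \<open>K\<close> deletes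
  entries and divides by the rank. Deleting only lowers the Hilbert-Schmidt norm, whose square is
  \<open>card I\<close> for \<open>A\<close>.\<close>

lemma norm_off_diagonal: "(norm K)\<^sup>2 \<le> 1 / card I"
proof -
  have "(norm K)\<^sup>2 \<le> (\<Sum>l\<in>L. \<Sum>m\<in>L. (cmod (cin (a l) (A *v a m)))\<^sup>2 / (card I)\<^sup>2)"
    unfolding onb_norm_mat[OF onb]
    by (intro sum_mono) (auto simp: coef_off_diagonal norm_divide power_divide)
  also have "\<dots> = (norm A)\<^sup>2 / (card I)\<^sup>2"
    by (simp add: onb_norm_mat[OF onb] sum_divide_distrib)
  also have "\<dots> = 1 / card I"
    unfolding norm_partial_isometry[OF x y] using card_I by (simp add: power2_eq_square)
  finally show ?thesis .
qed

text \<open>The apparently linear errors are quadratic: for the part \<open>u\<close> of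
  \<open>x i\<close> outside the range of its projection, \<open>A *v y i = x i\<close> makes
  \<open>cin u (A *v y i)\<close> equal to the squared norm of \<open>u\<close>, and similarly for
  \<open>y i\<close>. Together with the mixed term and the reversed summand there are four errors of
  at most \<delta>^2.\<close>

lemma inner_off_diagonal_ge:
  assumes near: "\<And>i. i \<in> I \<Longrightarrow>
      norm (x i - proj a T1 *v x i) \<le> \<delta> \<and> norm (y i - proj a T2 *v y i) \<le> \<delta> \<or>
      norm (x i - proj a T2 *v x i) \<le> \<delta> \<and> norm (y i - proj a T1 *v y i) \<le> \<delta>"
  shows "K \<bullet> A \<ge> 1 - 4 * \<delta>\<^sup>2"
proof -
  \<comment> \<open>General \<open>S1\<close> and \<open>S2\<close> cover both directions of the
    exchange; interchanging them only permutes the two summands.\<close>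
  have main: "Re (cin (proj a S1 *v x i) (A *v (proj a S2 *v y i))) +
      Re (cin (proj a S2 *v x i) (A *v (proj a S1 *v y i))) \<ge> 1 - 4 * \<delta>\<^sup>2"
    if i: "i \<in> I" and S: "S1 \<subseteq> L" "S2 \<subseteq> L" "S1 \<inter> S2 = {}"
      and dx: "norm (x i - proj a S1 *v x i) \<le> \<delta>" and dy: "norm (y i - proj a S2 *v y i) \<le> \<delta>" for i S1 S2
  proof -
    define u v where "u = x i - proj a S1 *v x i" and "v = y i - proj a S2 *v y i"
    have Re: "\<bar>Re (cin p (A *v q))\<bar> \<le> \<delta>\<^sup>2" if "norm p \<le> \<delta>" "norm q \<le> \<delta>" for p q
    proof -
      have "\<bar>Re (cin p (A *v q))\<bar> \<le> norm p * norm (A *v q)"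
        using abs_Re_le_cmod cmod_cin_le by (rule order_trans)
      also have "\<dots> \<le> \<delta> * \<delta>"
        using that norm_partial_isometry_le[OF x y, of q]
        by (intro mult_mono) (auto intro: order_trans[OF norm_ge_zero])
      finally show ?thesis by (simp add: power2_eq_square)
    qed
    have orth: "Re (cin (w - proj a S *v w) w) = (norm (w - proj a S *v w))\<^sup>2" if "S \<subseteq> L" for w S
    proof -
      have "cin (w - proj a S *v w) (proj a S *v w) = 0"
        unfolding proj_mult_vec[of a S w] cin_sum_right cin_scale_right
        using that arg_cong[OF cin_proj[OF onb_orthonormal[OF onb] that], where f = cnj]
        by (intro sum.neutral) (auto simp: cin_diff_left cin_cnj proj_mult_vec[symmetric])
      then have "cin (w - proj a S *v w) w = cin (w - proj a S *v w) (w - proj a S *v w)"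
        by (simp add: cin_diff_right)
      then show ?thesis by (simp add: cin_self)
    qed
    have "Re (cin u (A *v y i)) = (norm u)\<^sup>2"
      using orth[OF S(1), of "x i"] by (simp add: u_def partial_isometry_mult_basis[OF y i])
    then have 1: "Re (cin u (A *v y i)) \<le> \<delta>\<^sup>2"
      using dx by (simp add: u_def power_mono)
    have "Re (cin (x i) (A *v v)) = Re (cnj (cin v (y i)))"
      by (simp add: cin_partial_isometry[OF x i] cin_cnj)
    also have "\<dots> = (norm v)\<^sup>2" using orth[OF S(2), of "y i"] by (simp add: v_def)
    finally have 2: "Re (cin (x i) (A *v v)) \<le> \<delta>\<^sup>2"
      using dy by (simp add: v_def power_mono)
    have 3: "\<bar>Re (cin u (A *v v))\<bar> \<le> \<delta>\<^sup>2"
      using dx dy by (intro Re) (auto simp: u_def v_def)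
    have 4: "\<bar>Re (cin (proj a S2 *v x i) (A *v (proj a S1 *v y i)))\<bar> \<le> \<delta>\<^sup>2"
      using norm_proj_le_compl[OF onb S, of "x i"] norm_proj_le_compl[OF onb S(2,1), of "y i"] S(3) dx dy
      by (intro Re) (auto simp: Int_commute)
    have "cin (proj a S1 *v x i) (A *v (proj a S2 *v y i)) = cin (x i - u) (A *v (y i - v))"
      by (simp add: u_def v_def)
    also have "\<dots> = 1 - cin u (A *v y i) - cin (x i) (A *v v) + cin u (A *v v)"
      using cin_partial_isometry[OF x i, of y "y i"] orthonormalD[OF y i i]
      by (simp add: matrix_vector_mult_diff_distrib cin_diff_left cin_diff_right)
    finally have "Re (cin (proj a S1 *v x i) (A *v (proj a S2 *v y i)))
        = 1 - Re (cin u (A *v y i)) - Re (cin (x i) (A *v v)) + Re (cin u (A *v v))" by simp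
    then show ?thesis using 1 2 3 4 by linarith
  qed
  have "(\<Sum>i\<in>I. 1 - 4 * \<delta>\<^sup>2) \<le> (\<Sum>i\<in>I. Re (cin (proj a T1 *v x i) (A *v (proj a T2 *v y i))) +
      Re (cin (proj a T2 *v x i) (A *v (proj a T1 *v y i))))"
  proof (rule sum_mono)
    fix i assume i: "i \<in> I"
    from near[OF i] show "1 - 4 * \<delta>\<^sup>2 \<le> Re (cin (proj a T1 *v x i) (A *v (proj a T2 *v y i))) +
      Re (cin (proj a T2 *v x i) (A *v (proj a T1 *v y i)))"
      using main[OF i T] main[OF i T(2,1)] T(3) by (auto simp: Int_commute add.commute)
  qed
  then show ?thesis using card_I
    by (simp add: inner_off_diagonal le_divide_eq mult.commute)
qed

end

subsection \<open>Equilibration\<close>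

context eigenbasis
begin

text \<open>The frequencies repeat here, as every diagonal pair has gap 0. That is harmless for the
  existence of averages; the exact average of a squared norm needs the diagonal removed.\<close>

lemma heisenberg_quasiperiodic:
  "heisenberg H M = quasiperiodic (L \<times> L) (\<lambda>p. E (fst p) - E (snd p))
     (\<lambda>p. scale_mat (cin (a (fst p)) (M *v a (snd p))) (outer (a (fst p)) (a (snd p))))"
  unfolding quasiperiodic_def heisenberg_expand
  by (simp add: fun_eq_iff scale_mat_scale_mat sum.cartesian_product case_prod_unfold)

lemma continuous_on_heisenberg: "continuous_on UNIV (heisenberg H M)"
  unfolding heisenberg_quasiperiodic by (rule continuous_on_quasiperiodic)

text \<open>A vanishing diagonal leaves only pairs of distinct levels, whose gaps are pairwise
  different. The average is therefore a sum of rank-one contributions, each bounded by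
  \<open>norm_restriction_map_outer\<close>; for empty \<open>S\<close> each of them is 0 by
  orthogonality of the basis vectors.\<close>

lemma time_average_norm_restriction_map:
  assumes gaps: "inj_on (\<lambda>p. E (fst p) - E (snd p)) {p \<in> L \<times> L. fst p \<noteq> snd p}"
    and diag: "\<And>l. l \<in> L \<Longrightarrow> cin (a l) (M *v a l) = 0"
  obtains q where "has_time_average (\<lambda>t. (norm (restriction_map S (heisenberg H M t)))\<^sup>2) q"
    "q \<le> (norm M)\<^sup>2 / CARD('d) ^ card (-S)" "S = {} \<longrightarrow> q \<le> 0"
proof -
  let ?J = "{p \<in> L \<times> L. fst p \<noteq> snd p}"
  let ?w = "\<lambda>p. E (fst p) - E (snd p)"
  define c where "c p = cin (a (fst p)) (M *v a (snd p))" for p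
  define N where "N p = scale_mat (c p) (restriction_map S (outer (a (fst p)) (a (snd p))))" for p
  have on: "orthonormal L a" by (rule onb_orthonormal[OF onb])
  have fin: "finite L" by (rule orthonormal_finite[OF on])
  have "restriction_map S (heisenberg H M t) = quasiperiodic ?J ?w N t" for t
  proof -
    have "heisenberg H M t = (\<Sum>p\<in>L \<times> L. scale_mat (cis (t * ?w p)) (scale_mat (c p) (outer (a (fst p)) (a (snd p)))))"
      unfolding heisenberg_quasiperiodic quasiperiodic_def c_def ..
    also have "\<dots> = (\<Sum>p\<in>?J. scale_mat (cis (t * ?w p)) (scale_mat (c p) (outer (a (fst p)) (a (snd p)))))"
      using fin diag by (intro sum.mono_neutral_right) (auto simp: c_def scale_mat_scale_mat)
    finally show ?thesis
      by (simp add: restriction_map_sum restriction_map_scale quasiperiodic_def N_def)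
  qed
  then have avg: "has_time_average (\<lambda>t. (norm (restriction_map S (heisenberg H M t)))\<^sup>2) (\<Sum>p\<in>?J. (norm (N p))\<^sup>2)"
    using quasiperiodic_norm_sq_has_time_average[OF gaps, of N] by simp
  have "(\<Sum>p\<in>?J. (norm (N p))\<^sup>2) \<le> (\<Sum>p\<in>?J. (cmod (c p))\<^sup>2 * (1 / CARD('d) ^ card (-S)))"
  proof (rule sum_mono)
    fix p assume "p \<in> ?J"
    then show "(norm (N p))\<^sup>2 \<le> (cmod (c p))\<^sup>2 * (1 / CARD('d) ^ card (-S))"
      unfolding N_def norm_scale_mat power_mult_distrib
      by (intro mult_left_mono norm_restriction_map_outer orthonormal_norm[OF on]) auto
  qed
  also have "\<dots> \<le> (\<Sum>p\<in>L \<times> L. (cmod (c p))\<^sup>2 * (1 / CARD('d) ^ card (-S)))"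
    using fin by (intro sum_mono2) auto
  also have "\<dots> = (norm M)\<^sup>2 / CARD('d) ^ card (-S)"
    by (simp add: onb_norm_mat[OF onb, of M] c_def sum.cartesian_product case_prod_unfold flip: sum_divide_distrib)
  finally have le: "(\<Sum>p\<in>?J. (norm (N p))\<^sup>2) \<le> (norm M)\<^sup>2 / CARD('d) ^ card (-S)" .
  have "(\<Sum>p\<in>?J. (norm (N p))\<^sup>2) \<le> 0" if "S = {}"
    by (rule sum_nonpos)
      (auto simp: N_def that restriction_map_empty_outer orthonormalD[OF on] norm_scale_mat)
  then show ?thesis using that[OF avg le] by blast
qed

text \<open>\<open>K\<close> acts as a test functional dominated by the operator norm. Evolving it
  preserves this domination, because the evolution can be moved to the other factor and does not
  increase the operator norm there.\<close>

lemma time_average_lower_bound: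
  fixes A K :: "('x, 'd) observable" and dmin :: nat
  assumes gaps: "inj_on (\<lambda>p. E (fst p) - E (snd p)) {p \<in> L \<times> L. fst p \<noteq> snd p}"
    and diag: "\<And>l. l \<in> L \<Longrightarrow> cin (a l) (K *v a l) = 0"
    and A: "opnorm A \<le> 1" and K: "\<And>M. K \<bullet> M \<le> opnorm M" and KA: "1 - \<theta> \<le> K \<bullet> A"
    and dmin: "dmin \<ge> 1" and normK: "(norm K)\<^sup>2 \<le> 1 / (2 * dmin)" and d: "CARD('d) \<ge> 2"
  shows "\<exists>m. has_time_average (\<lambda>t. opnorm (heisenberg H A t - restriction_map S (heisenberg H A t))) m \<and>
    m \<ge> 1 - \<theta> - CARD('d) ^ card S / (2 * sqrt dmin)"
proof -
  define F where "F t = opnorm (heisenberg H A t - restriction_map S (heisenberg H A t))" for t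
  define G where "G t = (norm (restriction_map S (heisenberg H K t)))\<^sup>2" for t
  define r where "r = sqrt dmin"
  define D where "D = real (CARD('d) ^ card S)"
  define N where "N = real (CARD('d) ^ card (-S))"
  have r: "r > 0" "r\<^sup>2 = dmin" using dmin by (auto simp: r_def)
  have pos: "D > 0" "N > 0" by (auto simp: D_def N_def)
  \<comment> \<open>The factor \<open>N\<close> of the total dimension will cancel against the gain
    \<open>1 / N\<close> from restricting \<open>K\<close>.\<close>
  have DN: "real (CARD('x \<Rightarrow> 'd)) = D * N"
  proof -
    have "card (UNIV :: 'x set) = card S + card (-S)"
      by (metis card_Un_disjoint Compl_partition Compl_disjoint finite)
    then show ?thesis by (simp add: D_def N_def card_fun power_add flip: of_nat_mult of_nat_power)
  qed
  obtain q where q: "has_time_average G q" "q \<le> (norm K)\<^sup>2 / CARD('d) ^ card (-S)" "S = {} \<longrightarrow> q \<le> 0"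
    unfolding G_def by (rule time_average_norm_restriction_map[OF gaps diag, of S]) blast
  have cont\<Phi>: "continuous_on UNIV (\<lambda>M. opnorm (M - restriction_map S M))"
    by (intro continuous_on_compose2[OF continuous_on_opnorm] continuous_intros
        linear_continuous_on bounded_linear_restriction_map) auto
  obtain m where m: "has_time_average F m"
    using quasiperiodic_has_time_average[OF cont\<Phi>] unfolding F_def heisenberg_quasiperiodic by blast
  have contF: "continuous_on UNIV F"
    unfolding F_def by (intro continuous_on_compose2[OF cont\<Phi> continuous_on_heisenberg]) auto
  have contG: "continuous_on UNIV G"
    unfolding G_def
    by (intro continuous_intros continuous_on_heisenberg
        bounded_linear.continuous_on[OF bounded_linear_restriction_map])
  \<comment> \<open>Young's inequality with a free weight \<open>s\<close> replaces Cauchy-Schwarz.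
    It keeps the bound affine in \<open>G t\<close>, whose average is known, so that linearity and
    monotonicity of averages suffice.\<close>
  have F_ge: "1 - \<theta> - (s * G t + D * N / s) / 2 \<le> F t" if s: "s > 0" for s t
  proof -
    define k where "k = norm (restriction_map S (heisenberg H K t))"
    let ?A = "heisenberg H A t"
    have "heisenberg H K t \<bullet> (?A - restriction_map S ?A) \<le> F t"
    proof -
      have "heisenberg H K t \<bullet> (?A - restriction_map S ?A)
          \<le> opnorm (heisenberg H (?A - restriction_map S ?A) (- t))"
        unfolding inner_heisenberg by (rule K)
      also have "\<dots> \<le> F t" unfolding F_def by (rule opnorm_heisenberg_le)
      finally show ?thesis .
    qed
    moreover have "heisenberg H K t \<bullet> ?A = K \<bullet> A"
      by (simp add: inner_heisenberg heisenberg_heisenberg_minus)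
    ultimately have "K \<bullet> A - restriction_map S (heisenberg H K t) \<bullet> ?A \<le> F t"
      by (simp add: inner_diff_right inner_restriction_map)
    moreover have "restriction_map S (heisenberg H K t) \<bullet> ?A \<le> k * norm ?A"
      unfolding k_def by (rule norm_cauchy_schwarz)
    moreover have "k * norm ?A \<le> (s * k\<^sup>2 + (norm ?A)\<^sup>2 / s) / 2"
    proof -
      have "0 \<le> (s * k - norm ?A)\<^sup>2" by simp
      then have "2 * s * (k * norm ?A) \<le> s * (s * k\<^sup>2 + (norm ?A)\<^sup>2 / s)"
        using s by (simp add: power2_eq_square algebra_simps)
      then show ?thesis using s by simp
    qed
    moreover have "(norm ?A)\<^sup>2 / s \<le> D * N / s"
    proof -
      have "(norm ?A)\<^sup>2 \<le> D * N * (opnorm ?A)\<^sup>2"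
        using norm_sq_le_opnorm[of ?A] DN by simp
      also have "\<dots> \<le> D * N * 1"
        using order_trans[OF opnorm_heisenberg_le A] pos opnorm_nonneg[of ?A]
        by (intro mult_left_mono power_le_one) auto
      finally show ?thesis using s by (simp add: divide_right_mono)
    qed
    ultimately show ?thesis using KA by (simp add: G_def k_def field_simps)
  qed
  have m_ge: "1 - \<theta> - (s * q + D * N / s) / 2 \<le> m" if s: "s > 0" for s
  proof -
    have "has_time_average (\<lambda>t. (1 - \<theta> - D * N / s / 2) + (- s / 2) * G t) ((1 - \<theta> - D * N / s / 2) + (- s / 2) * q)"
      by (intro has_time_average_add has_time_average_const has_time_average_cmult q(1) continuous_intros contG)
    then have "(1 - \<theta> - D * N / s / 2) + (- s / 2) * q \<le> m"
    proof (rule has_time_average_mono[OF _ m _ contF])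
      show "(1 - \<theta> - D * N / s / 2) + (- s / 2) * G t \<le> F t" for t
        using F_ge[OF s, of t] by (simp add: algebra_simps add_divide_distrib)
    qed (intro continuous_intros contG)
    then show ?thesis by (simp add: algebra_simps add_divide_distrib)
  qed
  \<comment> \<open>The weight \<open>s\<close> balances the two error terms; for \<open>S = {}\<close> the first one vanishes, which
    compensates for the failure of \<open>D \<ge> 2\<close>.\<close>
  have "1 - \<theta> - D / (2 * r) \<le> m"
  proof (cases "S = {}")
    case True
    then have D: "D = 1" by (simp add: D_def)
    have "N * r * q \<le> 0" using q(3) True pos r by (simp add: mult_nonneg_nonpos)
    \<comment> \<open>Here \<open>D = 1\<close>, and \<open>s = N * r\<close> makes
      \<open>D * N / s / 2\<close> exactly the claimed error \<open>D / (2 * r)\<close>.\<close>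
    moreover have "(1 - \<theta> - D / (2 * r)) - N * r * q / 2 \<le> m"
      using m_ge[of "N * r"] pos r by (simp add: D add_divide_distrib algebra_simps)
    ultimately show ?thesis by simp
  next
    case False
    have "CARD('d) ^ 1 \<le> CARD('d) ^ card S"
      using False d by (intro power_increasing) (auto simp: Suc_le_eq card_gt_0_iff)
    then have "2 \<le> CARD('d) ^ card S" using d by simp
    then have D2: "D \<ge> 2" unfolding D_def by (metis of_nat_le_iff of_nat_numeral)
    have "q \<le> (norm K)\<^sup>2 / N" using q(2) by (simp add: N_def)
    also have "\<dots> \<le> 1 / (2 * r\<^sup>2) / N"
      using normK pos r by (intro divide_right_mono) auto
    finally have "2 * r * N * q \<le> 1 / r"
      using r(1) pos by (simp add: field_simps power2_eq_square)
    then have "1 - \<theta> - (1 / r + D / (2 * r)) / 2 \<le> 1 - \<theta> - (2 * r * N * q + D / (2 * r)) / 2"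
      by (intro diff_left_mono divide_right_mono add_right_mono) auto
    also have "\<dots> \<le> m"
      using m_ge[of "2 * r * N"] pos r by simp
    finally have "1 - \<theta> - (1 / r + D / (2 * r)) / 2 \<le> m" .
    \<comment> \<open>With \<open>s = 2 * r * N\<close> the total error is
      \<open>(2 + D) / (4 * r)\<close>, which is at most \<open>D / (2 * r)\<close> precisely
      because \<open>D \<ge> 2\<close>.\<close>
    moreover have "(1 / r + D / (2 * r)) / 2 \<le> D / (2 * r)"
      using D2 r by (simp add: field_simps)
    ultimately show ?thesis by linarith
  qed
  then show ?thesis using m unfolding F_def D_def r_def by (intro exI[of _ m]) auto
qed

end

subsection \<open>Non-degenerate Hamiltonians\<close>

lemma hermitian_eigenbasis:
  fixes A :: "('x::finite, 'd::finite) observable"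
  assumes A: "hermitian_mat A"
  obtains B E where "eigenbasis A B (\<lambda>b. b) E"
proof -
  obtain B where on: "orthonormal B (\<lambda>b. b)" and eig: "\<And>b. b \<in> B \<Longrightarrow> \<exists>e. A *v b = e *s b"
    and complete: "\<And>v. v \<in> UNIV \<Longrightarrow> (\<Sum>b\<in>B. cin b v *s b) = v"
    by (rule spectral_theorem_subspace[OF A vec.subspace_UNIV]) auto
  \<comment> \<open>Eigenvalues of a Hermitian matrix are real and equal the expectation value in
    the unit eigenvector, which gives an explicit energy function.\<close>
  have "A *v b = of_real (Re (cin b (A *v b))) *s b" if b: "b \<in> B" for b
  proof -
    obtain e where e: "A *v b = e *s b" using eig[OF b] by blast
    have "cin b b = 1" using orthonormalD[OF on b b] by simp
    then have "cin b (A *v b) = e" "cnj e = e"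
      using hermitian_cin[OF A, of b b] by (simp_all add: e cin_scale_left cin_scale_right)
    then show ?thesis by (simp add: e complex_eq_iff)
  qed
  then have "eigenbasis A B (\<lambda>b. b) (\<lambda>b. Re (cin b (A *v b)))"
    using on complete by (auto simp: eigenbasis_def onb_def)
  then show ?thesis by (rule that)
qed

context eigenbasis
begin

lemma basis_nonzero: "l \<in> L \<Longrightarrow> a l \<noteq> 0"
  using orthonormal_norm[OF onb_orthonormal[OF onb], of l] by auto

lemma energy_in_eigenvalues: "l \<in> L \<Longrightarrow> of_real (E l) \<in> eigenvalues H"
  using eig basis_nonzero by (auto simp: eigenvalues_def)

text \<open>Two basis vectors with the same energy would be orthogonal nonzero vectors in a
  one-dimensional eigenspace.\<close>

lemma inj_on_energy:
  assumes "nondegenerate_energies H"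
  shows "inj_on E L"
proof (rule inj_onI, rule ccontr)
  fix l m assume lm: "l \<in> L" "m \<in> L" "E l = E m" "l \<noteq> m"
  let ?V = "eigenspace H (of_real (E l))"
  have "vec.dim ?V = 1"
    using assms energy_in_eigenvalues[OF lm(1)] by (auto simp: nondegenerate_energies_def)
  then obtain w where "?V \<subseteq> vec.span {w}"
    using vec.basis_exists[of ?V] by (metis card_1_singletonE)
  then have sub: "?V \<subseteq> range (\<lambda>k. k *s w)" by (simp add: vec.span_singleton)
  have "a l \<in> ?V" "a m \<in> ?V"
    using lm eig by (auto simp: eigenspace_def)
  then have "a l \<in> range (\<lambda>k. k *s w)" "a m \<in> range (\<lambda>k. k *s w)" using sub by blast+
  then obtain c k where "a l = c *s w" "a m = k *s w" by blast
  moreover have "cin (a l) (a m) = 0"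
    using orthonormalD[OF onb_orthonormal[OF onb] lm(1,2)] lm(4) by simp
  ultimately show False
    using basis_nonzero[OF lm(1)] basis_nonzero[OF lm(2)]
    by (auto simp: cin_scale_left cin_scale_right cin_self)
qed

lemma inj_on_gaps:
  assumes ne: "nondegenerate_energies H" and ng: "nondegenerate_gaps H"
  shows "inj_on (\<lambda>p. E (fst p) - E (snd p)) {p \<in> L \<times> L. fst p \<noteq> snd p}"
proof (rule inj_onI)
  fix p q assume p: "p \<in> {p \<in> L \<times> L. fst p \<noteq> snd p}" and q: "q \<in> {p \<in> L \<times> L. fst p \<noteq> snd p}"
    and eq: "E (fst p) - E (snd p) = E (fst q) - E (snd q)"
  note inj = inj_on_energy[OF ne]
  have L: "fst p \<in> L" "snd p \<in> L" "fst q \<in> L" "snd q \<in> L" using p q by auto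
  have "E (fst q) \<noteq> E (snd q)" using q inj by (auto dest: inj_onD)
  then have "complex_of_real (E (fst p)) - of_real (E (snd p)) = of_real (E (fst q)) - of_real (E (snd q))
      \<and> complex_of_real (E (fst q)) - of_real (E (snd q)) \<noteq> 0"
    using eq by (simp flip: of_real_diff)
  then have "complex_of_real (E (fst p)) = of_real (E (fst q)) \<and> complex_of_real (E (snd p)) = of_real (E (snd q))"
    using ng L energy_in_eigenvalues unfolding nondegenerate_gaps_def by blast
  then show "p = q" using inj L by (auto simp: inj_on_def prod_eq_iff)
qed

text \<open>Evaluating \<open>H ** Z\<close> between \<open>a m\<close> and \<open>a l\<close> in
  both orders gives (E m - E l) times the matrix entry of \<open>Z\<close> equal to 0, and distinct
  levels have distinct energies.\<close>

lemma commuting_diagonal: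
  assumes ne: "nondegenerate_energies H" and comm: "H ** Z = Z ** H" and herm: "hermitian_mat H"
    and l: "l \<in> L"
  shows "Z *v a l = cin (a l) (Z *v a l) *s a l"
proof (rule onb_eqI[OF onb])
  fix m assume m: "m \<in> L"
  show "cin (a m) (Z *v a l) = cin (a m) (cin (a l) (Z *v a l) *s a l)"
  proof (cases "m = l")
    case False
    have "of_real (E m) * cin (a m) (Z *v a l) = cin (H *v a m) (Z *v a l)"
      by (simp add: eig[OF m] cin_scale_left)
    also have "\<dots> = cin (a m) (Z *v (H *v a l))"
      by (simp add: hermitian_cin[OF herm] matrix_vector_mul_assoc comm)
    also have "\<dots> = of_real (E l) * cin (a m) (Z *v a l)"
      by (simp add: eig[OF l] matvec_smult cin_scale_right)
    finally have "cin (a m) (Z *v a l) = 0"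
      using inj_on_energy[OF ne] l m False by (auto simp: inj_on_def)
    then show ?thesis
      using orthonormalD[OF onb_orthonormal[OF onb] m l] False by (simp add: cin_scale_right)
  qed (use orthonormalD[OF onb_orthonormal[OF onb] l l] in \<open>simp add: cin_scale_right\<close>)
qed

end

text \<open>For d = 1 there is a single configuration, so every operator is a scalar. The bound d
  \<ge> 2 makes d^|S| at least 2 on nonempty regions.\<close>

lemma CARD_ge_2_of_eigenvalues:
  fixes Z :: "('x::finite, 'd::finite) observable"
  assumes "z1 \<in> eigenvalues Z" "z2 \<in> eigenvalues Z" "z1 \<noteq> z2"
  shows "CARD('d) \<ge> 2"
proof (rule ccontr)
  assume "\<not> CARD('d) \<ge> 2"
  then have "CARD('d) = 1" using zero_less_card_finite[where 'a = 'd] by linarith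
  then obtain k where "(UNIV :: 'd set) = {k}" by (rule card_1_singletonE)
  then have k: "y = k" for y :: 'd by blast
  have UN: "(UNIV :: ('x \<Rightarrow> 'd) set) = {\<lambda>_. k}" using k by (auto simp: fun_eq_iff)
  have "z = Z $ (\<lambda>_. k) $ (\<lambda>_. k)" if z: "z \<in> eigenvalues Z" for z
  proof -
    obtain v where v: "v \<noteq> 0" "Z *v v = z *s v" using z by (auto simp: eigenvalues_def)
    have "v $ (\<lambda>_. k) \<noteq> 0"
    proof
      assume "v $ (\<lambda>_. k) = 0"
      then have "v $ \<sigma> = 0" for \<sigma> using UN by (metis UNIV_I singletonD)
      then show False using v(1) by (simp add: vec_eq_iff)
    qed
    moreover have "(Z *v v) $ (\<lambda>_. k) = Z $ (\<lambda>_. k) $ (\<lambda>_. k) * v $ (\<lambda>_. k)"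
      unfolding matrix_vector_mult_def vec_lambda_beta UN by simp
    ultimately show ?thesis using v(2) by simp
  qed
  then show False using assms by metis
qed

subsection \<open>The local operator\<close>

text \<open>Vectors are chosen among the local eigenvectors \<open>c\<close>, and each choice is
  tensored with every configuration of the complement. This yields an operator supported on
  \<open>S\<close>, and it costs nothing in the count, since the eigenvalue of a product vector
  depends only on \<open>c\<close>.\<close>

lemma approximately_local_swap:
  fixes Z :: "('x::finite, 'd::finite) observable"
  assumes herm: "hermitian_mat Z" and close: "opnorm (Z - restriction_map S Z) \<le> g"
    and onb: "onb L a" and eig: "\<And>l. l \<in> L \<Longrightarrow> Z *v a l = \<zeta> l *s a l"
    and gap1: "\<And>l. l \<in> L \<Longrightarrow> \<zeta> l \<noteq> z1 \<Longrightarrow> \<gamma> \<le> cmod (\<zeta> l - z1)"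
    and gap2: "\<And>l. l \<in> L \<Longrightarrow> \<zeta> l \<noteq> z2 \<Longrightarrow> \<gamma> \<le> cmod (\<zeta> l - z2)"
    and z12: "\<gamma> \<le> cmod (z1 - z2)" and g: "2 * g < \<gamma>"
    and dim1: "n \<le> vec.dim (eigenspace Z z1)" and dim2: "n \<le> vec.dim (eigenspace Z z2)" and n: "n \<ge> 1"
  obtains I :: "(((complex ^ ('x \<Rightarrow> 'd)) \<times> bool) \<times> ('x \<Rightarrow> 'd)) set" and x y
  where "two_projections L a {l \<in> L. \<zeta> l = z1} {l \<in> L. \<zeta> l = z2} I x y" "2 * n \<le> card I"
    "supported_on (partial_isometry I x y) S"
    "1 - 4 * (g / (\<gamma> - g))\<^sup>2 \<le> off_diagonal a {l \<in> L. \<zeta> l = z1} {l \<in> L. \<zeta> l = z2} I x y \<bullet> partial_isometry I x y"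
proof -
  let ?T1 = "{l \<in> L. \<zeta> l = z1}" and ?T2 = "{l \<in> L. \<zeta> l = z2}"
  define G where "G = (confs (-S) :: ('x \<Rightarrow> 'd) set)"
  have g0: "0 \<le> g" using opnorm_nonneg close by (rule order_trans)
  have ne: "z1 \<noteq> z2" using z12 g g0 by auto
  obtain C where C: "orthonormal C (\<lambda>c. c)" "C \<subseteq> local_vecs S"
    and onbC: "onb (C \<times> G) (\<lambda>p. tens S (fst p) (snd p))"
    and eigC: "\<And>c. c \<in> C \<Longrightarrow> \<exists>e. \<forall>\<eta>\<in>G. restriction_map S Z *v tens S c \<eta> = e *s tens S c \<eta>"
    unfolding G_def by (rule restriction_map_eigenbasis[OF herm, of S]) blast
  obtain \<mu> where \<mu>: "\<And>c \<eta>. c \<in> C \<Longrightarrow> \<eta> \<in> G \<Longrightarrow> restriction_map S Z *v tens S c \<eta> = \<mu> c *s tens S c \<eta>"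
    using eigC by metis
  define D where "D z = {c \<in> C. cmod (\<mu> c - z) \<le> g}" for z
  have finC: "finite C" by (rule orthonormal_finite[OF C(1)])
  have finD: "finite (D z)" for z using finC by (simp add: D_def)
  have card_D: "vec.dim (eigenspace Z z) \<le> card (D z) * card G" for z
  proof -
    have "vec.dim (eigenspace Z z) \<le> card {p \<in> C \<times> G. cmod (\<mu> (fst p) - z) \<le> g}"
      by (rule dim_eigenspace_le[OF onbC _ close]) (auto simp: \<mu>)
    also have "{p \<in> C \<times> G. cmod (\<mu> (fst p) - z) \<le> g} = D z \<times> G" by (auto simp: D_def)
    finally show ?thesis by (simp add: card_cartesian_product)
  qed
  \<comment> \<open>A local exchange must pair equally many vectors on both sides. The smaller set
    still suffices, as each of the two sets times \<open>card G\<close> dominates its own eigenspace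
    dimension.\<close>
  define w where "w = min (card (D z1)) (card (D z2))"
  have wn: "n \<le> w * card G"
    using card_D[of z1] card_D[of z2] dim1 dim2 by (auto simp: w_def min_def)
  obtain I1 where I1: "I1 \<subseteq> D z1" "card I1 = w" "finite I1"
    using obtain_subset_with_card_n[of w "D z1"] by (auto simp: w_def)
  obtain I2 where I2: "I2 \<subseteq> D z2" "card I2 = w" "finite I2"
    using obtain_subset_with_card_n[of w "D z2"] by (auto simp: w_def)
  obtain h where h: "bij_betw h I1 I2"
    using finite_same_card_bij[OF I1(3) I2(3)] I1(2) I2(2) by auto
  have hD: "h c \<in> D z2" if "c \<in> I1" for c
    using h I2(1) that by (auto dest: bij_betwE)
  \<comment> \<open>A vector close to both eigenvalues would place them within
    \<open>2 * g < \<gamma>\<close> of each other. Disjointness also makes the exchange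
    injective.\<close>
  have disj: "D z1 \<inter> D z2 = {}"
  proof -
    have False if "cmod (\<mu> c - z1) \<le> g" "cmod (\<mu> c - z2) \<le> g" for c
    proof -
      have "cmod (z1 - z2) \<le> cmod (\<mu> c - z1) + cmod (\<mu> c - z2)"
        using norm_triangle_ineq[of "z1 - \<mu> c" "\<mu> c - z2"] by (simp add: norm_minus_commute)
      then show False using that z12 g by linarith
    qed
    then show ?thesis by (auto simp: D_def)
  qed
  \<comment> \<open>The Boolean records the direction: \<open>True\<close> sends \<open>h c\<close>
    to \<open>c\<close>, \<open>False\<close> sends \<open>c\<close> to \<open>h c\<close>. Using
    each pair twice yields the factor 2 in \<open>2 * n \<le> card I\<close>.\<close>
  define I where "I = (I1 \<times> (UNIV :: bool set)) \<times> G"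
  define e f where "e j = (if snd j then fst j else h (fst j))"
    and "f j = (if snd j then h (fst j) else fst j)" for j :: "(complex ^ ('x \<Rightarrow> 'd)) \<times> bool"
  define x y where "x i = tens S (e (fst i)) (snd i)" and "y i = tens S (f (fst i)) (snd i)"
    for i :: "((complex ^ ('x \<Rightarrow> 'd)) \<times> bool) \<times> ('x \<Rightarrow> 'd)"
  have finI: "finite I" using I1(3) by (simp add: I_def G_def)
  have card_I: "card I = 2 * (w * card G)" by (simp add: I_def card_cartesian_product I1(2))
  have ne_h: "c \<noteq> h c'" if "c \<in> I1" "c' \<in> I1" for c c'
    using disj hD[OF that(2)] that(1) I1(1) by auto
  have h_inj: "h c = h c' \<longleftrightarrow> c = c'" if "c \<in> I1" "c' \<in> I1" for c c'
    using h that by (auto simp: bij_betw_def inj_on_def)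
  have inj: "inj_on (\<lambda>i. (e (fst i), snd i)) I" "inj_on (\<lambda>i. (f (fst i), snd i)) I"
    using ne_h ne_h[symmetric] h_inj by (auto simp: inj_on_def I_def e_def f_def)
  have sub: "(\<lambda>i. (e (fst i), snd i)) ` I \<subseteq> C \<times> G" "(\<lambda>i. (f (fst i), snd i)) ` I \<subseteq> C \<times> G"
    using I1(1) hD by (auto simp: I_def e_def f_def D_def)
  note onC = onb_orthonormal[OF onbC]
  have x: "orthonormal I x" and y: "orthonormal I y"
    using orthonormal_compose[OF onC inj(1) sub(1) finI] orthonormal_compose[OF onC inj(2) sub(2) finI]
    by (simp_all add: x_def[abs_def] y_def[abs_def])
  have "two_projections L a ?T1 ?T2 I x y"
  proof
    show "I \<noteq> {}" using card_I wn n by auto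
  qed (use onb x y ne in auto)
  then interpret tp: two_projections L a ?T1 ?T2 I x y .
  have near1: "norm (tens S c \<eta> - proj a ?T1 *v tens S c \<eta>) \<le> g / (\<gamma> - g)" if "c \<in> D z1" "\<eta> \<in> G" for c \<eta>
    by (rule norm_compl_proj_le[OF onb eig gap1 \<mu> _ _ close])
      (use that g g0 orthonormal_norm[OF onC, of "(c, \<eta>)"] in \<open>auto simp: D_def\<close>)
  have near2: "norm (tens S c \<eta> - proj a ?T2 *v tens S c \<eta>) \<le> g / (\<gamma> - g)" if "c \<in> D z2" "\<eta> \<in> G" for c \<eta>
    by (rule norm_compl_proj_le[OF onb eig gap2 \<mu> _ _ close])
      (use that g g0 orthonormal_norm[OF onC, of "(c, \<eta>)"] in \<open>auto simp: D_def\<close>)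
  have "1 - 4 * (g / (\<gamma> - g))\<^sup>2 \<le> tp.K \<bullet> tp.A"
  proof (rule tp.inner_off_diagonal_ge)
    fix i assume "i \<in> I"
    then have "fst (fst i) \<in> D z1" "h (fst (fst i)) \<in> D z2" "snd i \<in> G"
      using I1(1) hD by (auto simp: I_def)
    then show "norm (x i - proj a ?T1 *v x i) \<le> g / (\<gamma> - g) \<and> norm (y i - proj a ?T2 *v y i) \<le> g / (\<gamma> - g) \<or>
      norm (x i - proj a ?T2 *v x i) \<le> g / (\<gamma> - g) \<and> norm (y i - proj a ?T1 *v y i) \<le> g / (\<gamma> - g)"
      using near1 near2 by (cases "snd (fst i)") (simp_all add: x_def y_def e_def f_def)
  qed
  moreover have "supported_on tp.A S"
    using supported_on_sum_outer_tens[where I = "I1 \<times> UNIV" and e = e and f = f and S = S]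
    by (simp add: partial_isometry_def I_def x_def y_def G_def sum.cartesian_product case_prod_unfold)
  ultimately show ?thesis
    using that[OF \<open>two_projections L a ?T1 ?T2 I x y\<close>] card_I wn by simp
qed

theorem theorem1:
  fixes pos :: "'x::finite \<Rightarrow> int ^ 'n::finite"
    and H Z :: "('x, 'd::finite) observable"
    and X :: "'x set" and g :: "nat \<Rightarrow> real" and \<gamma> :: real and dmin :: nat
  assumes "cubic_lattice pos"
    and "hermitian_mat H"
    and "nondegenerate_energies H"
    and "nondegenerate_gaps H"
    and "approx_local_constant_of_motion pos H Z X g \<gamma>"
    and "dmin \<ge> 1"
    and "\<forall>e\<in>eigenvalues Z. vec.dim (eigenspace Z e) \<ge> dmin"
  shows "\<forall>l. \<exists>A :: ('x, 'd) observable.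
           supported_on A (nbhd pos X l) \<and> opnorm A = 1 \<and>
           (\<forall>S :: 'x set. \<exists>m.
              has_time_average
                (\<lambda>t. opnorm (heisenberg H A t - restriction_map S (heisenberg H A t))) m \<and>
              m \<ge> 1 - 13 * (g l / \<gamma>) - real (CARD('d) ^ card S) / (2 * sqrt (real dmin)))"
proof
  fix l
  let ?R = "nbhd pos X l"
  have hermZ: "hermitian_mat Z" and comm: "H ** Z = Z ** H" and \<gamma>: "\<gamma> > 0"
    and card2: "card (eigenvalues Z) \<ge> 2"
    and gap: "\<And>e f. e \<in> eigenvalues Z \<Longrightarrow> f \<in> eigenvalues Z \<Longrightarrow> e \<noteq> f \<Longrightarrow> cmod (e - f) \<ge> \<gamma>"
    and close: "opnorm (Z - restriction_map ?R Z) \<le> g l"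
    using assms(5) by (auto simp: approx_local_constant_of_motion_def)
  obtain B E where eb: "eigenbasis H B (\<lambda>b. b) E"
    by (rule hermitian_eigenbasis[OF assms(2)])
  interpret eigenbasis H B "\<lambda>b. b" E by (rule eb)
  show "\<exists>A :: ('x, 'd) observable.
           supported_on A ?R \<and> opnorm A = 1 \<and>
           (\<forall>S :: 'x set. \<exists>m.
              has_time_average
                (\<lambda>t. opnorm (heisenberg H A t - restriction_map S (heisenberg H A t))) m \<and>
              m \<ge> 1 - 13 * (g l / \<gamma>) - real (CARD('d) ^ card S) / (2 * sqrt (real dmin)))"
  proof (cases "13 * g l < \<gamma>")
    \<comment> \<open>The claimed bound is at most 0 here, and the identity, fixed by evolution and
      by restriction, has average 0.\<close>
    case False
    have "opnorm (mat 1 :: ('x, 'd) observable) = 1"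
    proof (rule antisym)
      show "opnorm (mat 1 :: ('x, 'd) observable) \<le> 1" by (rule opnorm_leI) simp
      show "1 \<le> opnorm (mat 1 :: ('x, 'd) observable)"
        using opnorm_bound[of "mat 1 :: ('x, 'd) observable" "axis undefined 1"] by simp
    qed
    moreover have "1 - 13 * (g l / \<gamma>) - real (CARD('d) ^ card S) / (2 * sqrt (real dmin)) \<le> 0" for S :: "'x set"
    proof -
      have "0 \<le> real (CARD('d) ^ card S) / (2 * sqrt (real dmin))" by simp
      moreover have "1 \<le> 13 * (g l / \<gamma>)" using False \<gamma> by (simp add: field_simps)
      ultimately show ?thesis by linarith
    qed
    moreover have "opnorm (heisenberg H (mat 1) t - restriction_map S (heisenberg H (mat 1) t)) = 0" for t S
      by (simp add: heisenberg_one restriction_map_one)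
    ultimately show ?thesis
      using supported_on_one has_time_average_const[of 0] by (intro exI[of _ "mat 1"]) auto
  next
    case True
    have g0: "0 \<le> g l" using opnorm_nonneg close by (rule order_trans)
    define \<zeta> where "\<zeta> b = cin b (Z *v b)" for b
    have eigZ: "Z *v b = \<zeta> b *s b" if "b \<in> B" for b
      unfolding \<zeta>_def by (rule commuting_diagonal[OF assms(3) comm assms(2) that])
    have \<zeta>: "\<zeta> b \<in> eigenvalues Z" if "b \<in> B" for b
      using eigZ[OF that] basis_nonzero[OF that] by (auto simp: eigenvalues_def)
    obtain z1 z2 where z: "z1 \<in> eigenvalues Z" "z2 \<in> eigenvalues Z" "z1 \<noteq> z2"
      using card2 by (metis card_le_Suc0_iff_eq card.infinite not_less_eq_eq numeral_2_eq_2 zero_le)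
    obtain I :: "(((complex ^ ('x \<Rightarrow> 'd)) \<times> bool) \<times> ('x \<Rightarrow> 'd)) set" and x y
      where tp: "two_projections B (\<lambda>b. b) {b \<in> B. \<zeta> b = z1} {b \<in> B. \<zeta> b = z2} I x y"
      and card: "2 * dmin \<le> card I" and supp: "supported_on (partial_isometry I x y) ?R"
      and KA: "1 - 4 * (g l / (\<gamma> - g l))\<^sup>2
        \<le> off_diagonal (\<lambda>b. b) {b \<in> B. \<zeta> b = z1} {b \<in> B. \<zeta> b = z2} I x y \<bullet> partial_isometry I x y"
    proof (rule approximately_local_swap[OF hermZ close onb eigZ])
      show "\<gamma> \<le> cmod (\<zeta> b - z1)" if "b \<in> B" "\<zeta> b \<noteq> z1" for b using gap[OF \<zeta>[OF that(1)] z(1) that(2)] .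
      show "\<gamma> \<le> cmod (\<zeta> b - z2)" if "b \<in> B" "\<zeta> b \<noteq> z2" for b using gap[OF \<zeta>[OF that(1)] z(2) that(2)] .
      show "\<gamma> \<le> cmod (z1 - z2)" using gap[OF z] .
      show "2 * g l < \<gamma>" using True g0 by linarith
      show "dmin \<le> vec.dim (eigenspace Z z1)" "dmin \<le> vec.dim (eigenspace Z z2)" "1 \<le> dmin"
        using assms(6,7) z by auto
    qed blast
    interpret tp: two_projections B "\<lambda>b. b" "{b \<in> B. \<zeta> b = z1}" "{b \<in> B. \<zeta> b = z2}" I x y by (rule tp)
    have KA': "1 - 13 * (g l / \<gamma>) \<le> tp.K \<bullet> tp.A"
    proof -
      \<comment> \<open>From \<open>13 * g l < \<gamma>\<close> follow \<open>u \<le> 1\<close> and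
        \<open>\<gamma> - g l \<ge> \<gamma> / 3\<close>, hence
        \<open>u \<le> 3 * (g l / \<gamma>)\<close>. So 4 u^2 \<le> 4 u \<le> 12 g / \<gamma>,
        within the allowed 13 g / \<gamma>.\<close>
      define u where "u = g l / (\<gamma> - g l)"
      have u0: "0 \<le> u" using g0 True by (simp add: u_def)
      have "u \<le> 1" using True g0 by (simp add: u_def)
      moreover have "u \<le> g l / (\<gamma> / 3)"
        unfolding u_def using True g0 \<gamma> by (intro divide_left_mono) auto
      ultimately have "u * u \<le> 1 * (3 * (g l / \<gamma>))" using u0 by (intro mult_mono) (auto simp: mult.commute)
      moreover have "0 \<le> g l / \<gamma>" using g0 \<gamma> by simp
      ultimately have "4 * u\<^sup>2 \<le> 13 * (g l / \<gamma>)" by (simp add: power2_eq_square)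
      then show ?thesis using KA by (simp add: u_def)
    qed
    have opA: "opnorm tp.A = 1" by (rule opnorm_partial_isometry[OF tp.x tp.y tp.I])
    have "(norm tp.K)\<^sup>2 \<le> 1 / card I" by (rule tp.norm_off_diagonal)
    also have "\<dots> \<le> 1 / (2 * dmin)"
      using card assms(6) by (intro divide_left_mono) (auto simp flip: of_nat_mult)
    finally have normK: "(norm tp.K)\<^sup>2 \<le> 1 / (2 * dmin)" by simp
    have "\<exists>m. has_time_average (\<lambda>t. opnorm (heisenberg H tp.A t - restriction_map S (heisenberg H tp.A t))) m \<and>
        m \<ge> 1 - 13 * (g l / \<gamma>) - real (CARD('d) ^ card S) / (2 * sqrt (real dmin))" for S
      by (rule time_average_lower_bound[OF inj_on_gaps[OF assms(3,4)] tp.coef_off_diagonal_diag _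
            tp.inner_off_diagonal_le KA' assms(6) normK CARD_ge_2_of_eigenvalues[OF z]])
        (simp_all add: opA)
    then show ?thesis using supp opA by (intro exI[of _ tp.A]) auto
  qed
qed

end
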